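(* Let $p$ be a prime, let $K$ and $L$ be $\mathbb{Z}_p$-complexes and let $n_K,n_L$ be positive integers. (1) If $p=2$, $A^{n_K}(K)\neq0$ modulo $2$ and $A^{n_L}(L)\neq0$ modulo $2$, then $A^{n_K+n_L+1}(K*L)\neq0$ modulo $2$. (2) If $n_K>0$ is even, $A^{n_K}(K)\neq0$ modulo $p$, and $A^{n_L}(L)\neq0$ modulo $p^m$ for some minimal $m\geq1$, then $A^{n_K+n_L+1}(K*L)\neq0$ modulo $p^m$ provided $A^{n_K}(K)$ has a dual which is boundary-equivariant modulo $p^m$.
   Context: All simplicial complexes are finite. A $\mathbb{Z}_p$-complex is a simplicial complex $K$ with a simplicial automorphism $t$, $t^p=\mathrm{id}$, such that $t^k\sigma\neq\sigma$ for every non-empty simplex $\sigma$ and every $k\not\equiv0 \pmod p$. The join $K*L$ is a $\mathbb{Z}_p$-complex via the action of $t$ on the vertices of each factor. $C_*(K)$, $C^*(K)$ are the integral simplicial chain and cochain complexes (dimensions $\geq 0$); $t$ also denotes the induced maps; $d=1-t$, $s=1+t+\cdots+t^{p-1}$. Let $C^i_d(K)=\ker(d)=\mathrm{im}(s)\subset C^i(K)$ and $C^i_s(K)=\ker(s)=\mathrm{im}(d)\subset C^i(K)$; these are subcomplexes with cohomologies $H^i_d(K)$, $H^i_s(K)$. A resolution of $1$ is a sequence $\phi_j\in C^j(K)$, $j\ge 0$, with $s\phi_0=1$ (the cochain with value $1$ on each vertex), $\delta\phi_j=d\phi_{j+1}$ for $j$ even, $\delta\phi_j=s\phi_{j+1}$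 for $j$ odd. The $j$-th Smith class $A^j(K)$ is $[s\phi_j]\in H^j_d(K)$ if $j$ is even and $[d\phi_j]\in H^j_s(K)$ if $j$ is odd; it is independent of the resolution. "Modulo $n$" refers to the image under coefficient reduction $\mathbb{Z}\to\mathbb{Z}/n$ (in the cohomology of $C^*_d(K)\otimes\mathbb{Z}/n$, resp. $C^*_s(K)\otimes\mathbb{Z}/n$). "Minimal $m$" means the smallest integer $m\ge1$ with $A^{n_L}(L)\ne0$ modulo $p^m$. For $j$ even and $A^j(K)=[s\phi]$, a chain $c\in C_j(K)$ is a dual of $A^j(K)$ if $s\partial c\equiv0 \pmod p$ and $\phi(sc)\not\equiv0\pmod p$. It is boundary-equivariant modulo $q$ if $d\partial c\equiv 0\pmod q$, i.e. $t\partial c\equiv\partial c\pmod q$. *)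

theory Defs
  imports
    "HOL-Algebra.Coset"
    "HOL-Algebra.Elementary_Groups"
    "HOL-Combinatorics.Permutations"
    "HOL-Computational_Algebra.Primes"
    "HOL-Library.Function_Algebras"
begin

section \<open>Simplicial complexes with a free action of a cyclic group\<close>

text \<open>
  A complex is the set of its simplices; the empty simplex always belongs to it, so that
  \<open>K\<close> and \<open>L\<close> are subcomplexes of their join.
\<close>

definition finite_complex :: "'a set set \<Rightarrow> bool" where
  "finite_complex K \<longleftrightarrow> finite K \<and> {} \<in> K \<and>
     (\<forall>\<sigma>\<in>K. finite \<sigma> \<and> (\<forall>\<tau>. \<tau> \<subseteq> \<sigma> \<longrightarrow> \<tau> \<in> K))"

text \<open>
  The generator \<open>t\<close> is a permutation of the vertex set \<open>\<Union>K\<close>, extended by the identity to the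
  whole vertex type.
\<close>

definition zp_complex :: "nat \<Rightarrow> 'a set set \<Rightarrow> ('a \<Rightarrow> 'a) \<Rightarrow> bool" where
  "zp_complex p K t \<longleftrightarrow> finite_complex K \<and> t permutes \<Union>K \<and> (`) t ` K = K \<and> t ^^ p = id \<and>
     (\<forall>k. \<not> p dvd k \<longrightarrow> (\<forall>\<sigma>\<in>K. \<sigma> \<noteq> {} \<longrightarrow> (t ^^ k) ` \<sigma> \<noteq> \<sigma>))"

definition complex_join :: "'a set set \<Rightarrow> 'b set set \<Rightarrow> ('a + 'b) set set" where
  "complex_join K L = {\<sigma> <+> \<tau> | \<sigma> \<tau>. \<sigma> \<in> K \<and> \<tau> \<in> L}"


section \<open>Integral simplicial chains and cochains\<close>

text \<open>
  A simplicial chain is an alternating integer-valued function on oriented simplices, an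
  orientation being given by an ordering of the vertices: \<open>c [v\<^sub>0, \<dots>, v\<^sub>j]\<close> is the coefficient in
  \<open>c\<close> of the oriented simplex \<open>[v\<^sub>0, \<dots>, v\<^sub>j]\<close>.
  Adjacent transpositions generate all reorderings.
\<close>

type_synonym 'a chain = "'a list \<Rightarrow> int"
type_synonym 'a cochain = "'a chain \<Rightarrow> int"

definition ordered_simplices :: "'a set set \<Rightarrow> nat \<Rightarrow> 'a list set" where
  "ordered_simplices K j = {w. distinct w \<and> length w = Suc j \<and> set w \<in> K}"

definition simp_chains :: "'a set set \<Rightarrow> nat \<Rightarrow> 'a chain set" where
  "simp_chains K j = {c. (\<forall>w. w \<notin> ordered_simplices K j \<longrightarrow> c w = 0) \<and>
     (\<forall>xs x y ys. c (xs @ x # y # ys) = - c (xs @ y # x # ys))}"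

text \<open>
  The usual \<open>\<partial>[v\<^sub>0, \<dots>, v\<^sub>j] = (\<Sum>i. (-1)^i [v\<^sub>0, \<dots>, (omit v\<^sub>i), \<dots>, v\<^sub>j])\<close> in terms of coefficients:
  the oriented simplices having \<open>w\<close> in their boundary with coefficient 1 are the \<open>v # w\<close>.
  The clause for \<open>[]\<close> makes the complex vanish in dimension -1.
\<close>

definition simp_boundary :: "'a set set \<Rightarrow> 'a chain \<Rightarrow> 'a chain" where
  "simp_boundary K c = (\<lambda>w. if w = [] then 0 else (\<Sum>v\<in>\<Union>K. c (v # w)))"

text \<open>The push-forward of chains: \<open>[v\<^sub>0, \<dots>, v\<^sub>j]\<close> is sent to \<open>[t v\<^sub>0, \<dots>, t v\<^sub>j]\<close>.\<close>

definition chain_act :: "('a \<Rightarrow> 'a) \<Rightarrow> 'a chain \<Rightarrow> 'a chain" where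
  "chain_act t c = (\<lambda>w. c (map (inv_into UNIV t) w))"

definition add_group :: "'g::comm_monoid_add set \<Rightarrow> 'g monoid" where
  "add_group S = \<lparr>carrier = S, monoid.mult = (+), one = 0\<rparr>"

text \<open>
  \<open>C\<^sup>j(K) = Hom(C\<^sub>j(K), \<int>)\<close>, homomorphisms being extended by 0 to arguments which are not chains.
\<close>

definition simp_cochains :: "'a set set \<Rightarrow> nat \<Rightarrow> 'a cochain set" where
  "simp_cochains K j =
     {\<phi> \<in> hom (add_group (simp_chains K j)) integer_group. \<forall>c. c \<notin> simp_chains K j \<longrightarrow> \<phi> c = 0}"

definition simp_coboundary :: "'a set set \<Rightarrow> nat \<Rightarrow> 'a cochain \<Rightarrow> 'a cochain" where
  "simp_coboundary K j \<phi> = (\<lambda>c. if c \<in> simp_chains K (Suc j) then \<phi> (simp_boundary K c) else 0)"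

definition cochain_act :: "('a \<Rightarrow> 'a) \<Rightarrow> 'a cochain \<Rightarrow> 'a cochain" where
  "cochain_act t \<phi> = (\<lambda>c. \<phi> (chain_act t c))"

definition unit_cochain :: "'a set set \<Rightarrow> 'a cochain" where
  "unit_cochain K = (\<lambda>c. if c \<in> simp_chains K 0 then (\<Sum>v\<in>\<Union>K. c [v]) else 0)"

text \<open>\<open>d = 1 - t\<close> and \<open>s = 1 + t + \<dots> + t\<^bsup>p-1\<^esup>\<close>, where \<open>T\<close> is the action of \<open>t\<close> on chains or cochains.\<close>

definition dop :: "('x \<Rightarrow> 'x) \<Rightarrow> 'x \<Rightarrow> 'x::ab_group_add" where
  "dop T x = x - T x"

definition sop :: "nat \<Rightarrow> ('x \<Rightarrow> 'x) \<Rightarrow> 'x \<Rightarrow> 'x::ab_group_add" where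
  "sop p T x = (\<Sum>k<p. (T ^^ k) x)"

definition chain_cong_0 :: "'a chain \<Rightarrow> nat \<Rightarrow> bool" where
  "chain_cong_0 c q \<longleftrightarrow> (\<forall>w. int q dvd c w)"


section \<open>Cohomology of a cochain complex and reduction of coefficients\<close>

definition coboundaries :: "(nat \<Rightarrow> 'g monoid) \<Rightarrow> (nat \<Rightarrow> 'g \<Rightarrow> 'g) \<Rightarrow> nat \<Rightarrow> 'g set" where
  "coboundaries G D j = (case j of 0 \<Rightarrow> {\<one>\<^bsub>G 0\<^esub>} | Suc i \<Rightarrow> D i ` carrier (G i))"

definition cohom :: "(nat \<Rightarrow> 'g monoid) \<Rightarrow> (nat \<Rightarrow> 'g \<Rightarrow> 'g) \<Rightarrow> nat \<Rightarrow> 'g set monoid" where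
  "cohom G D j = (G j)\<lparr>carrier := kernel (G j) (G (Suc j)) (D j)\<rparr> Mod coboundaries G D j"

definition cohom_class :: "(nat \<Rightarrow> 'g monoid) \<Rightarrow> (nat \<Rightarrow> 'g \<Rightarrow> 'g) \<Rightarrow> nat \<Rightarrow> 'g \<Rightarrow> 'g set" where
  "cohom_class G D j x = coboundaries G D j #>\<^bsub>G j\<^esub> x"

text \<open>
  For a complex \<open>C\<close> of groups of integer-valued functions, \<open>C \<otimes> \<int>/n\<close> is the complex \<open>C / n C\<close>
  with the induced differential.
\<close>

definition multiples :: "(nat \<Rightarrow> ('x \<Rightarrow> int) set) \<Rightarrow> nat \<Rightarrow> nat \<Rightarrow> ('x \<Rightarrow> int) set" where
  "multiples C n i = (\<lambda>\<phi> x. int n * \<phi> x) ` C i"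

definition mod_complex ::
  "(nat \<Rightarrow> ('x \<Rightarrow> int) set) \<Rightarrow> nat \<Rightarrow> nat \<Rightarrow> ('x \<Rightarrow> int) set monoid" where
  "mod_complex C n i = add_group (C i) Mod multiples C n i"

definition mod_proj ::
  "(nat \<Rightarrow> ('x \<Rightarrow> int) set) \<Rightarrow> nat \<Rightarrow> nat \<Rightarrow> ('x \<Rightarrow> int) \<Rightarrow> ('x \<Rightarrow> int) set" where
  "mod_proj C n i \<phi> = multiples C n i #>\<^bsub>add_group (C i)\<^esub> \<phi>"

definition mod_diff ::
  "(nat \<Rightarrow> ('x \<Rightarrow> int) set) \<Rightarrow> (nat \<Rightarrow> ('x \<Rightarrow> int) \<Rightarrow> ('x \<Rightarrow> int)) \<Rightarrow> nat \<Rightarrow>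
     nat \<Rightarrow> ('x \<Rightarrow> int) set \<Rightarrow> ('x \<Rightarrow> int) set" where
  "mod_diff C D n i X = the_elem ((\<lambda>\<phi>. mod_proj C n (Suc i) (D i \<phi>)) ` X)"

text \<open>The map \<open>H\<^sup>j(C) \<rightarrow> H\<^sup>j(C \<otimes> \<int>/n)\<close> induced by the projection; its argument is a coset of cocycles.\<close>

definition coeff_reduction ::
  "(nat \<Rightarrow> ('x \<Rightarrow> int) set) \<Rightarrow> (nat \<Rightarrow> ('x \<Rightarrow> int) \<Rightarrow> ('x \<Rightarrow> int)) \<Rightarrow> nat \<Rightarrow>
     nat \<Rightarrow> ('x \<Rightarrow> int) set \<Rightarrow> ('x \<Rightarrow> int) set set" where
  "coeff_reduction C D n j X =
     the_elem ((\<lambda>\<phi>. cohom_class (mod_complex C n) (mod_diff C D n) j (mod_proj C n j \<phi>)) ` X)"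


section \<open>Smith classes\<close>

definition ker_d :: "'a set set \<Rightarrow> ('a \<Rightarrow> 'a) \<Rightarrow> nat \<Rightarrow> 'a cochain set" where
  "ker_d K t i = {\<phi> \<in> simp_cochains K i. dop (cochain_act t) \<phi> = 0}"

definition ker_s :: "nat \<Rightarrow> 'a set set \<Rightarrow> ('a \<Rightarrow> 'a) \<Rightarrow> nat \<Rightarrow> 'a cochain set" where
  "ker_s p K t i = {\<phi> \<in> simp_cochains K i. sop p (cochain_act t) \<phi> = 0}"

definition resolution :: "nat \<Rightarrow> 'a set set \<Rightarrow> ('a \<Rightarrow> 'a) \<Rightarrow> (nat \<Rightarrow> 'a cochain) \<Rightarrow> bool" where
  "resolution p K t \<phi> \<longleftrightarrow>
     (\<forall>j. \<phi> j \<in> simp_cochains K j) \<and>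
     sop p (cochain_act t) (\<phi> 0) = unit_cochain K \<and>
     (\<forall>j. even j \<longrightarrow> simp_coboundary K j (\<phi> j) = dop (cochain_act t) (\<phi> (Suc j))) \<and>
     (\<forall>j. odd j \<longrightarrow> simp_coboundary K j (\<phi> j) = sop p (cochain_act t) (\<phi> (Suc j)))"

text \<open>The complex in whose cohomology the \<open>j\<close>-th Smith class lives; only the parity of \<open>j\<close> matters.\<close>

definition smith_complex :: "nat \<Rightarrow> 'a set set \<Rightarrow> ('a \<Rightarrow> 'a) \<Rightarrow> nat \<Rightarrow> nat \<Rightarrow> 'a cochain set" where
  "smith_complex p K t j = (if even j then ker_d K t else ker_s p K t)"

definition smith_cohom_class ::
  "nat \<Rightarrow> 'a set set \<Rightarrow> ('a \<Rightarrow> 'a) \<Rightarrow> nat \<Rightarrow> 'a cochain \<Rightarrow> 'a cochain set" where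
  "smith_cohom_class p K t j x =
     cohom_class (\<lambda>i. add_group (smith_complex p K t j i)) (simp_coboundary K) j x"

text \<open>Resolutions exist, and the class does not depend on the one chosen.\<close>

definition smith_class :: "nat \<Rightarrow> 'a set set \<Rightarrow> ('a \<Rightarrow> 'a) \<Rightarrow> nat \<Rightarrow> 'a cochain set" where
  "smith_class p K t j =
     (let \<phi> = (SOME \<phi>. resolution p K t \<phi>) in
      smith_cohom_class p K t j
        (if even j then sop p (cochain_act t) (\<phi> j) else dop (cochain_act t) (\<phi> j)))"

definition smith_class_mod ::
  "nat \<Rightarrow> 'a set set \<Rightarrow> ('a \<Rightarrow> 'a) \<Rightarrow> nat \<Rightarrow> nat \<Rightarrow> 'a cochain set set" where
  "smith_class_mod p K t n j =
     coeff_reduction (smith_complex p K t j) (simp_coboundary K) n j (smith_class p K t j)"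

definition smith_cohom_mod ::
  "nat \<Rightarrow> 'a set set \<Rightarrow> ('a \<Rightarrow> 'a) \<Rightarrow> nat \<Rightarrow> nat \<Rightarrow> 'a cochain set set monoid" where
  "smith_cohom_mod p K t n j =
     cohom (mod_complex (smith_complex p K t j) n)
       (mod_diff (smith_complex p K t j) (simp_coboundary K) n) j"

definition smith_nonzero_mod :: "nat \<Rightarrow> 'a set set \<Rightarrow> ('a \<Rightarrow> 'a) \<Rightarrow> nat \<Rightarrow> nat \<Rightarrow> bool" where
  "smith_nonzero_mod p K t n j \<longleftrightarrow> smith_class_mod p K t n j \<noteq> \<one>\<^bsub>smith_cohom_mod p K t n j\<^esub>"

text \<open>
  Duals are meant for even \<open>j\<close>.  If \<open>s \<partial> c\<close> vanishes modulo \<open>p\<close>, the residue of \<open>\<phi> (s c)\<close> is the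
  same for all cochains \<open>\<phi>\<close> such that \<open>s \<phi>\<close> represents the Smith class.
\<close>

definition smith_dual :: "nat \<Rightarrow> 'a set set \<Rightarrow> ('a \<Rightarrow> 'a) \<Rightarrow> nat \<Rightarrow> 'a chain \<Rightarrow> bool" where
  "smith_dual p K t j c \<longleftrightarrow> c \<in> simp_chains K j \<and>
     (\<exists>\<phi>\<in>simp_cochains K j.
        smith_class p K t j = smith_cohom_class p K t j (sop p (cochain_act t) \<phi>) \<and>
        chain_cong_0 (sop p (chain_act t) (simp_boundary K c)) p \<and>
        \<not> int p dvd \<phi> (sop p (chain_act t) c))"

definition boundary_equivariant_mod ::
  "nat \<Rightarrow> 'a set set \<Rightarrow> ('a \<Rightarrow> 'a) \<Rightarrow> 'a chain \<Rightarrow> bool" where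
  "boundary_equivariant_mod q K t c \<longleftrightarrow> chain_cong_0 (dop (chain_act t) (simp_boundary K c)) q"

end

(*
  Write D_j (in the code: smop) for s if j is even and for d if j is odd, so that a resolution satisfies
  delta phi_j = D_(j+1) phi_(j+1), and A^j vanishes modulo q iff D_j phi_j is congruent to delta psi
  modulo q for some psi in ker D_(j+1).

  Let phi be a resolution of 1 on K*L, let c be a chain on K of dimension n_K whose boundary b is
  t-invariant modulo q, and assume n_K even or p = q = 2.  Then the cochains
  chi_j(e) = phi_(n_K+j)(b*e) form, modulo q, a resolution of u times 1 on L, where
  u = phi_(n_K)(D c) is computed by the restriction of phi to K.  By exactness of s and d modulo q, the
  class of D chi_(n_L) is therefore u A^(n_L)(L).  On the other hand the boundary of c*De is
  b*De + c*(D boundary e) up to sign, so, with N = n_K+n_L+1, a presentation of D phi_N as a coboundary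
  modulo q turns into one of D chi_(n_L).  If u is a unit modulo q, vanishing of A^N(K*L) thus
  implies vanishing of A^(n_L)(L).  In part (2) c is the given dual; for p = 2 a suitable c comes
  from linear duality over the field with two elements.
*)

theory Submission
  imports Defs
begin

section \<open>Chains\<close>

text \<open>The condition "n_K even or p = q = 2" has two sources, both met when passing from e on L
  to b * e on the join. The dimension grows by n_K, so D_j on L faces D_(n_K+j) on the join; and the
  boundary of b * e carries the sign (-1)^n_K. For even n_K both discrepancies disappear. For p = 2
  the operators s = 1 + t and d = 1 - t agree modulo 2, and signs are invisible there. Invariance of
  b modulo q is what allows an operator applied to e alone to be traded for the operator applied to
  b * e. Chains are augmented by the empty simplex: the boundary formula for joins then has no
  exceptional cases, and u is the value of phi at b joined with the empty simplex. Congruences of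
  cochains are expressed by divisibility of their values on chains, with q = 0 meaning equality.
  Thus one exactness lemma and one comparison lemma serve both the integral statements (existence
  and independence of resolutions) and the comparison modulo q.\<close>

lemma sum_fun_apply: "(\<Sum>i\<in>I. f i) x = (\<Sum>i\<in>I. f i x)" for f :: "'i \<Rightarrow> 'x \<Rightarrow> 'y::comm_monoid_add"
  by (induction I rule: infinite_finite_induct) auto

definition alternating :: "'a chain \<Rightarrow> bool" where
  "alternating c \<longleftrightarrow> (\<forall>xs x y ys. c (xs @ x # y # ys) = - c (xs @ y # x # ys))"

text \<open>Graded by the number \<open>n\<close> of vertices and not by dimension, so that degrees
  add under joins. Degree 0 consists of multiples of the empty simplex: the augmentation
  term.\<close>

definition aug_chains :: "'a set set \<Rightarrow> nat \<Rightarrow> 'a chain set" where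
  "aug_chains K n = {c. (\<forall>w. c w \<noteq> 0 \<longrightarrow> distinct w \<and> length w = n \<and> set w \<in> K) \<and> alternating c}"

text \<open>Without the cut-off of \<open>simp_boundary\<close> at \<open>[]\<close>: for a chain of
  dimension 0 the value at \<open>[]\<close> is the sum of its coefficients. From dimension 1 on the
  two boundaries agree, as such chains vanish on lists of length 1.\<close>

definition aug_boundary :: "'a set set \<Rightarrow> 'a chain \<Rightarrow> 'a chain" where
  "aug_boundary K c = (\<lambda>w. \<Sum>v\<in>\<Union>K. c (v # w))"

lemma finite_complexD:
  assumes "finite_complex K"
  shows "finite (\<Union>K)" "{} \<in> K" "\<sigma> \<in> K \<Longrightarrow> \<tau> \<subseteq> \<sigma> \<Longrightarrow> \<tau> \<in> K"
  using assms unfolding finite_complex_def by auto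

lemma simp_chains_eq: "simp_chains K j = aug_chains K (Suc j)"
  unfolding simp_chains_def aug_chains_def ordered_simplices_def alternating_def by blast

lemma alternatingI:
  "(\<And>xs x y ys. c (xs @ x # y # ys) = - c (xs @ y # x # ys)) \<Longrightarrow> alternating c"
  unfolding alternating_def by blast

lemma alternatingD: "alternating c \<Longrightarrow> c (xs @ x # y # ys) = - c (xs @ y # x # ys)"
  unfolding alternating_def by blast

lemma alternating_swap: "alternating c \<Longrightarrow> c (x # y # ys) = - c (y # x # ys)"
  using alternatingD[of c "[]" x y ys] by simp

lemma aug_chainsD:
  assumes "c \<in> aug_chains K n" "c w \<noteq> 0"
  shows "distinct w" "length w = n" "set w \<in> K"
  using assms unfolding aug_chains_def by blast+

lemma aug_chains_alternating: "c \<in> aug_chains K n \<Longrightarrow> alternating c"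
  unfolding aug_chains_def by blast

lemma alternating_scale: "alternating c \<Longrightarrow> alternating (\<lambda>w. a * c w)"
  by (rule alternatingI, subst alternatingD) auto

lemma alternating_add:
  assumes "alternating c" "alternating c'"
  shows "alternating (c + c')"
proof (rule alternatingI)
  fix xs x y ys
  show "(c + c') (xs @ x # y # ys) = - (c + c') (xs @ y # x # ys)"
    using alternatingD[OF assms(1), of xs x y ys] alternatingD[OF assms(2), of xs x y ys] by simp
qed

lemma aug_chains_scale: "c \<in> aug_chains K n \<Longrightarrow> (\<lambda>w. a * c w) \<in> aug_chains K n"
  unfolding aug_chains_def by (auto intro!: alternating_scale)

lemma aug_chains_0: "0 \<in> aug_chains K n"
  unfolding aug_chains_def alternating_def by auto

lemma aug_chains_add:
  assumes "c \<in> aug_chains K n" "c' \<in> aug_chains K n"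
  shows "c + c' \<in> aug_chains K n"
proof -
  have "c w \<noteq> 0 \<or> c' w \<noteq> 0" if "(c + c') w \<noteq> 0" for w
    using that by auto
  moreover have "alternating (c + c')"
    using assms by (intro alternating_add aug_chains_alternating)
  ultimately show ?thesis
    using assms unfolding aug_chains_def by blast
qed

lemma aug_chains_uminus: "c \<in> aug_chains K n \<Longrightarrow> - c \<in> aug_chains K n"
  using aug_chains_scale[of c K n "-1"] by (simp add: fun_Compl_def)

lemma aug_chains_diff: "c \<in> aug_chains K n \<Longrightarrow> c' \<in> aug_chains K n \<Longrightarrow> c - c' \<in> aug_chains K n"
  using aug_chains_add[OF _ aug_chains_uminus, of c K n c'] by simp

lemma aug_chains_sum: "(\<And>i. i \<in> I \<Longrightarrow> f i \<in> aug_chains K n) \<Longrightarrow> (\<Sum>i\<in>I. f i) \<in> aug_chains K n"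
  by (induction I rule: infinite_finite_induct) (auto intro: aug_chains_0 aug_chains_add)

text \<open>The condition sees only the vertex set, which reordering does not change, so alternation
  survives the restriction.\<close>

lemma aug_chains_if:
  assumes "c \<in> aug_chains K n"
  shows "(\<lambda>w. if P (set w) then c w else 0) \<in> aug_chains K n"
proof -
  let ?c = "\<lambda>w. if P (set w) then c w else 0"
  have "?c (xs @ x # y # ys) = - ?c (xs @ y # x # ys)" for xs x y ys
    using alternatingD[OF aug_chains_alternating[OF assms], of xs x y ys]
    by (simp add: insert_commute)
  then have "alternating ?c" by (rule alternatingI)
  then show ?thesis
    using assms unfolding aug_chains_def by auto
qed

lemma aug_boundary_chain:
  assumes "finite_complex K" "c \<in> aug_chains K (Suc n)"
  shows "aug_boundary K c \<in> aug_chains K n"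
proof -
  have "distinct w \<and> length w = n \<and> set w \<in> K" if nz: "aug_boundary K c w \<noteq> 0" for w
  proof -
    obtain v where "c (v # w) \<noteq> 0"
      using nz unfolding aug_boundary_def by (meson sum.neutral)
    from aug_chainsD[OF assms(2) this] show ?thesis
      using finite_complexD(3)[OF assms(1), of "set (v # w)" "set w"] by auto
  qed
  moreover
  have *: "c (v # xs @ x # y # ys) = - c (v # xs @ y # x # ys)" for v xs x y ys
    using alternatingD[OF aug_chains_alternating[OF assms(2)], of "v # xs" x y ys] by simp
  have "alternating (aug_boundary K c)"
    unfolding aug_boundary_def
    by (intro alternatingI)
      (simp only: sum_negf[symmetric] append_Cons[symmetric], rule sum.cong[OF refl], simp only:
        append_Cons, rule *)
  ultimately show ?thesis
    unfolding aug_chains_def by blast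
qed

lemma aug_boundary_add: "aug_boundary K (c + c') = aug_boundary K c + aug_boundary K c'"
  unfolding aug_boundary_def by (auto simp: sum.distrib)

lemma aug_boundary_sum: "aug_boundary K (\<Sum>i\<in>I. f i) = (\<Sum>i\<in>I. aug_boundary K (f i))"
  unfolding aug_boundary_def
  by (rule ext) (simp add: sum_fun_apply sum.swap[of _ I])

lemma aug_boundary_diff: "aug_boundary K (c - c') = aug_boundary K c - aug_boundary K c'"
  unfolding aug_boundary_def by (auto simp: sum_subtractf)

text \<open>Exchanging the two added vertices negates every term and permutes the double sum, which
  is therefore its own negative.\<close>

lemma aug_boundary_boundary:
  assumes "alternating c"
  shows "aug_boundary K (aug_boundary K c) = 0"
proof
  fix w
  let ?S = "\<Sum>v\<in>\<Union>K. \<Sum>u\<in>\<Union>K. c (u # v # w)"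
  have "?S = (\<Sum>v\<in>\<Union>K. \<Sum>u\<in>\<Union>K. - c (v # u # w))"
    by (intro sum.cong refl alternating_swap assms)
  also have "\<dots> = - ?S"
    by (subst sum.swap) (simp add: sum_negf)
  finally show "aug_boundary K (aug_boundary K c) w = 0 w"
    unfolding aug_boundary_def by simp
qed

lemma simp_boundary_eq:
  assumes "c \<in> simp_chains K (Suc j)"
  shows "simp_boundary K c = aug_boundary K c"
proof
  fix w
  have "c [v] = 0" for v
    using aug_chainsD(2)[of c K "Suc (Suc j)" "[v]"] assms by (auto simp: simp_chains_eq)
  then show "simp_boundary K c w = aug_boundary K c w"
    unfolding simp_boundary_def aug_boundary_def by simp
qed

lemma chain_act_add: "chain_act t (c + c') = chain_act t c + chain_act t c'"
  unfolding chain_act_def by auto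

lemma chain_act_pow: "(chain_act t ^^ k) c w = c (map (inv_into UNIV t ^^ k) w)"
proof (induction k arbitrary: w)
  case (Suc k)
  have "map (inv_into UNIV t ^^ Suc k) w = map (inv_into UNIV t ^^ k) (map (inv_into UNIV t) w)"
    by (simp add: funpow_swap1)
  moreover have "(chain_act t ^^ Suc k) c w = (chain_act t ^^ k) c (map (inv_into UNIV t) w)"
    by (simp add: chain_act_def)
  ultimately show ?case by (simp only: Suc)
qed simp

definition smop :: "nat \<Rightarrow> nat \<Rightarrow> ('x \<Rightarrow> 'x) \<Rightarrow> 'x \<Rightarrow> 'x::ab_group_add" where
  "smop p j T = (if even j then sop p T else dop T)"

text \<open>Both s d and d s telescope to 1 - T^p. Only additivity of \<open>T\<close> is involved,
  so chains and cochains are covered together.\<close>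

lemma smop_smop_Suc:
  assumes "\<And>x y. T (x + y) = T x + T y" "(T ^^ p) x = x"
  shows "smop p j T (smop p (Suc j) T x) = 0" "smop p (Suc j) T (smop p j T x) = 0"
proof -
  have *: "(T ^^ k) (x + y) = (T ^^ k) x + (T ^^ k) y" for k x y
    by (induction k) (auto simp: assms)
  have m: "(T ^^ k) (x - y) = (T ^^ k) x - (T ^^ k) y" for k x y
    using *[of k "x - y" y] by simp
  have tel: "(\<Sum>k<n. (T ^^ k) x - (T ^^ Suc k) x) = x - (T ^^ n) x" for n
    by (induction n) auto
  have sd: "sop p T (dop T x) = 0"
    using tel[of p] assms(2) unfolding sop_def dop_def m by (simp add: funpow_swap1)
  have T0: "T 0 = 0" using assms(1)[of 0 0] by simp
  have "T (\<Sum>k<n. (T ^^ k) x) = (\<Sum>k<n. (T ^^ Suc k) x)" for n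
    by (induction n) (auto simp: assms(1) T0)
  then have "dop T (sop p T x) = (\<Sum>k<p. (T ^^ k) x - (T ^^ Suc k) x)"
    unfolding sop_def dop_def by (simp only: sum_subtractf)
  then have "dop T (sop p T x) = 0"
    using assms(2) by (simp only: tel diff_self)
  with sd show "smop p j T (smop p (Suc j) T x) = 0" "smop p (Suc j) T (smop p j T x) = 0"
    unfolding smop_def by auto
qed

lemma smop_Suc_Suc: "smop p (Suc (Suc j)) T = smop p j T"
  unfolding smop_def by simp

lemma smop_parity: "even i = even j \<Longrightarrow> smop p i T = smop p j T"
  unfolding smop_def by simp

section \<open>Cochains\<close>

lemma simp_cochains_iff:
  "\<phi> \<in> simp_cochains K j \<longleftrightarrow>
     (\<forall>c\<in>simp_chains K j. \<forall>c'\<in>simp_chains K j. \<phi> (c + c') = \<phi> c + \<phi> c') \<and>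
     (\<forall>c. c \<notin> simp_chains K j \<longrightarrow> \<phi> c = 0)"
  unfolding simp_cochains_def hom_def add_group_def by auto

lemma simp_cochainsI:
  assumes "\<And>c c'. c \<in> simp_chains K j \<Longrightarrow> c' \<in> simp_chains K j \<Longrightarrow> \<phi> (c + c') = \<phi> c + \<phi> c'"
    and "\<And>c. c \<notin> simp_chains K j \<Longrightarrow> \<phi> c = 0"
  shows "\<phi> \<in> simp_cochains K j"
  using assms by (simp add: simp_cochains_iff)

lemmas simp_chains_closed =
  aug_chains_0[of K "Suc j" for K j, folded simp_chains_eq]
  aug_chains_add[of _ K "Suc j" for K j, folded simp_chains_eq]
  aug_chains_uminus[of _ K "Suc j" for K j, folded simp_chains_eq]
  aug_chains_diff[of _ K "Suc j" for K j, folded simp_chains_eq]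
  aug_chains_scale[of _ K "Suc j" for K j, folded simp_chains_eq]
  aug_chains_sum[of _ _ K "Suc j" for K j, folded simp_chains_eq]

lemma cochain_outside: "\<phi> \<in> simp_cochains K j \<Longrightarrow> c \<notin> simp_chains K j \<Longrightarrow> \<phi> c = 0"
  by (simp add: simp_cochains_iff)

lemma cochain_ext:
  assumes "\<phi> \<in> simp_cochains K j" "\<psi> \<in> simp_cochains K j"
    and "\<And>c. c \<in> simp_chains K j \<Longrightarrow> \<phi> c = \<psi> c"
  shows "\<phi> = \<psi>"
proof
  show "\<phi> c = \<psi> c" for c
    using assms(3) cochain_outside[OF assms(1)] cochain_outside[OF assms(2)]
    by (cases "c \<in> simp_chains K j") simp_all
qed

lemma eval_add:
  "\<phi> \<in> simp_cochains K j \<Longrightarrow> c \<in> simp_chains K j \<Longrightarrow> c' \<in> simp_chains K j \<Longrightarrow>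
     \<phi> (c + c') = \<phi> c + \<phi> c'"
  by (simp add: simp_cochains_iff)

lemma eval_diff:
  "\<phi> \<in> simp_cochains K j \<Longrightarrow> c \<in> simp_chains K j \<Longrightarrow> c' \<in> simp_chains K j \<Longrightarrow>
     \<phi> (c - c') = \<phi> c - \<phi> c'"
  using eval_add[of \<phi> K j "c - c'" c'] by (simp add: simp_chains_closed)

lemma eval_0: "\<phi> \<in> simp_cochains K j \<Longrightarrow> \<phi> 0 = 0"
  using eval_diff[of \<phi> K j 0 0] by (simp add: simp_chains_closed)

lemma eval_uminus: "\<phi> \<in> simp_cochains K j \<Longrightarrow> c \<in> simp_chains K j \<Longrightarrow> \<phi> (- c) = - \<phi> c"
  using eval_diff[of \<phi> K j 0 c] by (simp add: simp_chains_closed eval_0)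

lemma eval_sum:
  assumes "\<phi> \<in> simp_cochains K j" "\<And>i. i \<in> I \<Longrightarrow> f i \<in> simp_chains K j"
  shows "\<phi> (\<Sum>i\<in>I. f i) = (\<Sum>i\<in>I. \<phi> (f i))"
  using assms(2)
proof (induction I rule: infinite_finite_induct)
  case (insert x F)
  then have "\<phi> (f x + sum f F) = \<phi> (f x) + (\<Sum>i\<in>F. \<phi> (f i))"
    using eval_add[OF assms(1), of "f x" "sum f F"] by (simp add: simp_chains_closed)
  then show ?case
    by (simp only: sum.insert[OF insert(1,2)])
qed (use assms eval_0 in auto)

text \<open>A cochain is by definition merely additive; natural multiples follow by induction,
  negative ones by a change of sign.\<close>

lemma eval_scale:
  assumes "\<phi> \<in> simp_cochains K j" "c \<in> simp_chains K j"
  shows "\<phi> (\<lambda>w. a * c w) = a * \<phi> c"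
proof -
  have n: "\<phi> (\<lambda>w. int n * c w) = int n * \<phi> c" for n
  proof (induction n)
    case 0
    then show ?case using eval_0[OF assms(1)] by (simp add: zero_fun_def)
  next
    case (Suc n)
    have "(\<lambda>w. int (Suc n) * c w) = (\<lambda>w. int n * c w) + c"
      by (auto simp: algebra_simps)
    then show ?case
      using Suc eval_add[OF assms(1) simp_chains_closed(5)[OF assms(2)] assms(2)]
      by (simp add: algebra_simps)
  qed
  show ?thesis
  proof (cases "a \<ge> 0")
    case True
    then show ?thesis using n[of "nat a"] by simp
  next
    case False
    have "(\<lambda>w. a * c w) = - (\<lambda>w. int (nat (- a)) * c w)"
      using False by auto
    then have "\<phi> (\<lambda>w. a * c w) = - \<phi> (\<lambda>w. int (nat (- a)) * c w)"
      by (simp only: eval_uminus[OF assms(1) simp_chains_closed(5)[OF assms(2)]])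
    then show ?thesis
      using False by (simp only: n) simp
  qed
qed

text \<open>The division of all coefficients by \<open>q\<close> is exact, hence respects the sign
  rule and gives a chain whose \<open>q\<close>-fold is \<open>c\<close>. Cochains are thereby well
  defined on chains modulo \<open>q\<close>.\<close>

lemma eval_dvd:
  assumes "\<phi> \<in> simp_cochains K j" "c \<in> simp_chains K j" "\<And>w. q dvd c w"
  shows "q dvd \<phi> c"
proof -
  have "(\<lambda>w. c w div q) \<in> simp_chains K j"
  proof -
    have "c w \<noteq> 0" if "c w div q \<noteq> 0" for w using that by auto
    moreover have "alternating (\<lambda>w. c w div q)"
    proof (rule alternatingI)
      fix xs x y ys
      have "alternating c" using assms(2) aug_chains_alternating by (auto simp: simp_chains_eq)
      from alternatingD[OF this, of xs x y ys]
      show "c (xs @ x # y # ys) div q = - (c (xs @ y # x # ys) div q)"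
        using assms(3)[of "xs @ y # x # ys"] by (simp add: dvd_neg_div)
    qed
    ultimately show ?thesis
      using assms(2) unfolding simp_chains_eq aug_chains_def by blast
  qed
  from eval_scale[OF assms(1) this, of q] show ?thesis
    using assms(3) by simp
qed

lemma eval_dvd_diff:
  assumes "\<phi> \<in> simp_cochains K j" "c \<in> simp_chains K j" "c' \<in> simp_chains K j"
    and "\<And>w. q dvd c w - c' w"
  shows "q dvd \<phi> c - \<phi> c'"
  using eval_dvd[OF assms(1), of "c - c'" q] assms eval_diff[OF assms(1-3)]
  by (simp add: simp_chains_closed)

lemma cochain_0: "0 \<in> simp_cochains K j"
  by (simp add: simp_cochains_iff)

lemma cochain_add: "\<phi> \<in> simp_cochains K j \<Longrightarrow> \<psi> \<in> simp_cochains K j \<Longrightarrow> \<phi> + \<psi> \<in> simp_cochains K j"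
  by (simp add: simp_cochains_iff)

lemma cochain_diff: "\<phi> \<in> simp_cochains K j \<Longrightarrow> \<psi> \<in> simp_cochains K j \<Longrightarrow> \<phi> - \<psi> \<in> simp_cochains K j"
  by (simp add: simp_cochains_iff)

lemma cochain_uminus: "\<phi> \<in> simp_cochains K j \<Longrightarrow> - \<phi> \<in> simp_cochains K j"
  by (simp add: simp_cochains_iff)

lemma cochain_scale: "\<phi> \<in> simp_cochains K j \<Longrightarrow> (\<lambda>c. a * \<phi> c) \<in> simp_cochains K j"
  by (simp add: simp_cochains_iff distrib_left)

lemma cochain_sum:
  "(\<And>i. i \<in> I \<Longrightarrow> f i \<in> simp_cochains K j) \<Longrightarrow> (\<Sum>i\<in>I. f i) \<in> simp_cochains K j"
  by (induction I rule: infinite_finite_induct) (auto intro: cochain_0 cochain_add)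

lemma cochain_act_pow: "(cochain_act t ^^ k) \<phi> c = \<phi> ((chain_act t ^^ k) c)"
proof (induction k arbitrary: c)
  case (Suc k)
  then show ?case
    by (simp add: cochain_act_def[of t "(cochain_act t ^^ k) \<phi>"]) (simp add: funpow_swap1)
qed simp

lemma cochain_act_add: "cochain_act t (\<phi> + \<psi>) = cochain_act t \<phi> + cochain_act t \<psi>"
  unfolding cochain_act_def by auto

lemma simp_coboundary_apply:
  "c \<in> simp_chains K (Suc j) \<Longrightarrow> simp_coboundary K j \<phi> c = \<phi> (aug_boundary K c)"
  by (simp add: simp_coboundary_def simp_boundary_eq)

lemma aug_boundary_simp_chain:
  "finite_complex K \<Longrightarrow> c \<in> simp_chains K (Suc j) \<Longrightarrow> aug_boundary K c \<in> simp_chains K j"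
  by (simp add: simp_chains_eq aug_boundary_chain)

lemma cochain_coboundary:
  assumes "finite_complex K" "\<phi> \<in> simp_cochains K j"
  shows "simp_coboundary K j \<phi> \<in> simp_cochains K (Suc j)"
proof (rule simp_cochainsI)
  fix c c' assume "c \<in> simp_chains K (Suc j)" "c' \<in> simp_chains K (Suc j)"
  then show "simp_coboundary K j \<phi> (c + c') = simp_coboundary K j \<phi> c + simp_coboundary K j \<phi> c'"
    using assms by (simp add: simp_coboundary_apply simp_chains_closed aug_boundary_add eval_add
        aug_boundary_simp_chain)
qed (simp add: simp_coboundary_def)

lemma simp_coboundary_add:
  "simp_coboundary K j (\<phi> + \<psi>) = simp_coboundary K j \<phi> + simp_coboundary K j \<psi>"
  unfolding simp_coboundary_def by auto

lemma simp_coboundary_coboundary: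
  assumes "finite_complex K" "\<phi> \<in> simp_cochains K j"
  shows "simp_coboundary K (Suc j) (simp_coboundary K j \<phi>) = 0"
proof
  fix c
  show "simp_coboundary K (Suc j) (simp_coboundary K j \<phi>) c = 0 c"
  proof (cases "c \<in> simp_chains K (Suc (Suc j))")
    case True
    then have "alternating c" using aug_chains_alternating by (auto simp: simp_chains_eq)
    then show ?thesis
      using True assms
      by (simp add: simp_coboundary_apply aug_boundary_simp_chain aug_boundary_boundary eval_0)
  qed (simp add: simp_coboundary_def)
qed

lemma unit_cochain_in: "unit_cochain K \<in> simp_cochains K 0"
  by (rule simp_cochainsI) (auto simp: unit_cochain_def simp_chains_closed sum.distrib)

lemma unit_cochain_aug: "c \<in> simp_chains K 0 \<Longrightarrow> unit_cochain K c = aug_boundary K c []"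
  by (simp add: unit_cochain_def aug_boundary_def)

lemma coboundary_unit_cochain:
  assumes "finite_complex K"
  shows "simp_coboundary K 0 (unit_cochain K) = 0"
proof
  fix c
  show "simp_coboundary K 0 (unit_cochain K) c = 0 c"
  proof (cases "c \<in> simp_chains K 1")
    case True
    then have "alternating c" using aug_chains_alternating by (auto simp: simp_chains_eq)
    with True show ?thesis
      using unit_cochain_aug[OF aug_boundary_simp_chain[of K c 0]] assms
      by (simp add: simp_coboundary_apply aug_boundary_boundary)
  qed (simp add: simp_coboundary_def)
qed

text \<open>The cut-off outside the chain group follows the convention of
  \<open>simp_cochains\<close>, under which cochains that agree on chains are equal.\<close>

definition cochain_of :: "'a set set \<Rightarrow> nat \<Rightarrow> ('a chain \<Rightarrow> int) \<Rightarrow> 'a cochain" where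
  "cochain_of K j f = (\<lambda>c. if c \<in> simp_chains K j then f c else 0)"

lemma cochain_of_in:
  "(\<And>c c'. c \<in> simp_chains K j \<Longrightarrow> c' \<in> simp_chains K j \<Longrightarrow> f (c + c') = f c + f c') \<Longrightarrow>
     cochain_of K j f \<in> simp_cochains K j"
  by (rule simp_cochainsI) (auto simp: cochain_of_def simp_chains_closed)

lemma cochain_of_apply: "c \<in> simp_chains K j \<Longrightarrow> cochain_of K j f c = f c"
  by (simp add: cochain_of_def)

section \<open>The operators s and d on chains and cochains of a complex with free action\<close>

locale zp_cx =
  fixes p :: nat and K :: "'a set set" and t :: "'a \<Rightarrow> 'a"
  assumes zp: "zp_complex p K t" and p_pos: "0 < p"
begin

lemma fin: "finite_complex K"
  and perm: "t permutes \<Union>K"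
  and image_K: "(`) t ` K = K"
  and t_pow: "t ^^ p = id"
  and free: "\<not> p dvd k \<Longrightarrow> \<sigma> \<in> K \<Longrightarrow> \<sigma> \<noteq> {} \<Longrightarrow> (t ^^ k) ` \<sigma> \<noteq> \<sigma>"
  using zp unfolding zp_complex_def by blast+

lemma bij_t: "bij t"
  using perm by (rule permutes_bij)

lemma inv_t_pow: "inv_into UNIV t ^^ p = id"
  using inv_fn[OF bij_t, of p] t_pow by simp

lemma T_pow: "(chain_act t ^^ p) c = c"
  by (rule ext) (simp add: chain_act_pow inv_t_pow)

lemma pow_image_in: "\<sigma> \<in> K \<Longrightarrow> (t ^^ k) ` \<sigma> \<in> K"
proof (induction k)
  case (Suc k)
  have "(t ^^ Suc k) ` \<sigma> = t ` ((t ^^ k) ` \<sigma>)" by auto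
  then show ?case using Suc image_K by (metis imageI)
qed simp

lemma T_aug_chain:
  assumes "c \<in> aug_chains K n"
  shows "chain_act t c \<in> aug_chains K n"
proof -
  have inj: "inj (inv_into UNIV t)"
    using bij_t by (simp add: bij_imp_bij_inv bij_is_inj)
  have "distinct w \<and> length w = n \<and> set w \<in> K" if "chain_act t c w \<noteq> 0" for w
  proof -
    from that have "c (map (inv_into UNIV t) w) \<noteq> 0" by (simp add: chain_act_def)
    note D = aug_chainsD[OF assms this]
    have "t ` set (map (inv_into UNIV t) w) = set w"
      using bij_t by (simp add: image_comp bij_is_surj surj_iff[symmetric] comp_def surj_f_inv_f)
    then show ?thesis
      using D pow_image_in[of "set (map (inv_into UNIV t) w)" 1] by (simp add: distinct_map)
  qed
  moreover have "alternating (chain_act t c)"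
    unfolding chain_act_def
    by (intro alternatingI) (simp only: map_append list.map, rule alternatingD[OF
      aug_chains_alternating[OF assms]])
  ultimately show ?thesis
    unfolding aug_chains_def by blast
qed

lemma T_chain: "c \<in> simp_chains K j \<Longrightarrow> chain_act t c \<in> simp_chains K j"
  by (simp add: simp_chains_eq T_aug_chain)

lemma T_pow_chain: "c \<in> simp_chains K j \<Longrightarrow> (chain_act t ^^ k) c \<in> simp_chains K j"
  by (induction k) (auto intro: T_chain)

lemma smop_chain: "c \<in> simp_chains K j \<Longrightarrow> smop p i (chain_act t) c \<in> simp_chains K j"
  unfolding smop_def sop_def dop_def
  by (auto intro!: simp_chains_closed T_chain T_pow_chain)

text \<open>As \<open>t\<close> permutes the vertices, the sum over the added vertex can be
  reindexed.\<close>

lemma boundary_T: "aug_boundary K (chain_act t c) = chain_act t (aug_boundary K c)"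
proof
  fix w
  have "(\<Sum>v\<in>\<Union>K. c (inv_into UNIV t v # map (inv_into UNIV t) w)) = (\<Sum>v\<in>\<Union>K. c (v # map
    (inv_into UNIV t) w))"
    using sum.permute[OF permutes_inv[OF perm], of "\<lambda>v. c (v # map (inv_into UNIV t) w)"]
    by (simp add: comp_def)
  then show "aug_boundary K (chain_act t c) w = chain_act t (aug_boundary K c) w"
    by (simp add: aug_boundary_def chain_act_def)
qed

lemma boundary_T_pow: "aug_boundary K ((chain_act t ^^ k) c) = (chain_act t ^^ k) (aug_boundary K c)"
  by (induction k) (auto simp: boundary_T)

lemma boundary_smop: "aug_boundary K (smop p i (chain_act t) c) = smop p i (chain_act t)
  (aug_boundary K c)"
  unfolding smop_def sop_def dop_def
  by (simp add: aug_boundary_sum aug_boundary_diff boundary_T boundary_T_pow)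

lemma cochain_T: "\<phi> \<in> simp_cochains K j \<Longrightarrow> cochain_act t \<phi> \<in> simp_cochains K j"
proof (rule simp_cochainsI)
  fix c assume "\<phi> \<in> simp_cochains K j" "c \<notin> simp_chains K j"
  \<comment> \<open>Non-chains are sent to non-chains, because the inverse of the action is its
    power \<open>p - 1\<close>.\<close>
  moreover have "c \<in> simp_chains K j" if "chain_act t c \<in> simp_chains K j"
  proof -
    have "(chain_act t ^^ p) c = (chain_act t ^^ (p - 1)) (chain_act t c)"
      using p_pos by (cases p) (auto simp: funpow_swap1)
    then show ?thesis using T_pow_chain[OF that, of "p - 1"] T_pow by simp
  qed
  ultimately show "cochain_act t \<phi> c = 0"
    unfolding cochain_act_def by (meson cochain_outside)
qed (simp add: cochain_act_def chain_act_add eval_add T_chain)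

lemma cochain_smop:
  assumes "\<phi> \<in> simp_cochains K j"
  shows "smop p i (cochain_act t) \<phi> \<in> simp_cochains K j"
proof -
  have "(cochain_act t ^^ k) \<phi> \<in> simp_cochains K j" for k
    using assms by (induction k) (auto intro: cochain_T)
  then show ?thesis
    using assms unfolding smop_def sop_def dop_def
    by (auto intro!: cochain_sum cochain_diff cochain_T)
qed

text \<open>\<open>cochain_act\<close> is precomposition with \<open>chain_act\<close>, so a
  polynomial in \<open>t\<close> can be moved from the cochain to its argument. The congruences
  below are written in this evaluated form.\<close>

lemma smop_eval:
  assumes "\<phi> \<in> simp_cochains K j" "c \<in> simp_chains K j"
  shows "smop p i (cochain_act t) \<phi> c = \<phi> (smop p i (chain_act t) c)"
proof -
  have "sop p (cochain_act t) \<phi> c = \<phi> (sop p (chain_act t) c)"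
    unfolding sop_def using assms
    by (simp add: sum_fun_apply cochain_act_pow eval_sum T_pow_chain)
  moreover have "dop (cochain_act t) \<phi> c = \<phi> (dop (chain_act t) c)"
    unfolding dop_def using assms by (simp add: cochain_act_def eval_diff T_chain)
  ultimately show ?thesis unfolding smop_def by simp
qed

lemma smop_coboundary:
  assumes "\<phi> \<in> simp_cochains K j"
  shows "smop p i (cochain_act t) (simp_coboundary K j \<phi>) = simp_coboundary K j (smop p i
    (cochain_act t) \<phi>)"
  by (rule cochain_ext[where K = K and j = "Suc j"])
    (use assms in \<open>simp_all add: cochain_smop cochain_coboundary fin smop_eval
      smop_eval[OF cochain_coboundary] simp_coboundary_apply
      smop_chain boundary_smop aug_boundary_simp_chain\<close>)

lemma smop_cochain_smop:
  assumes "\<phi> \<in> simp_cochains K j"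
  shows "smop p i (cochain_act t) (smop p (Suc i) (cochain_act t) \<phi>) = 0"
    "smop p (Suc i) (cochain_act t) (smop p i (cochain_act t) \<phi>) = 0"
proof -
  have "(cochain_act t ^^ p) \<phi> = \<phi>" by (rule ext) (simp add: cochain_act_pow T_pow)
  from smop_smop_Suc[OF cochain_act_add this]
  show "smop p i (cochain_act t) (smop p (Suc i) (cochain_act t) \<phi>) = 0"
    "smop p (Suc i) (cochain_act t) (smop p i (cochain_act t) \<phi>) = 0" by blast+
qed

end

section \<open>Resolutions\<close>

context zp_cx
begin

section \<open>Freeness of the action and exactness of s and d\<close>

lemma inv_t_pow_diff: "k \<le> p \<Longrightarrow> inv_into UNIV t ^^ (p - k) = t ^^ k"
proof -
  assume "k \<le> p"
  have "inv_into UNIV (t ^^ k) \<circ> t ^^ k = id"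
    using bij_fn[OF bij_t, of k] by (simp add: bij_is_inj)
  then have "inv_into UNIV t ^^ k \<circ> t ^^ k = id"
    by (simp only: inv_fn[OF bij_t])
  then have "inv_into UNIV t ^^ (p - k) = (inv_into UNIV t ^^ (p - k) \<circ> inv_into UNIV t ^^ k) \<circ> t ^^ k"
    by (simp add: comp_assoc)
  also have "\<dots> = t ^^ k"
    using \<open>k \<le> p\<close> by (simp add: inv_t_pow flip: funpow_add)
  finally show ?thesis .
qed

lemma pow_image_mod: "(t ^^ (k mod p)) ` \<sigma> = (t ^^ k) ` \<sigma>"
  using funpow_mod_eq[where f = t and n = p] t_pow by simp

text \<open>If the k-th and l-th translates agree with k < l < p, then \<open>t ^^ (l - k)\<close>
  fixes a non-empty simplex, contrary to freeness.\<close>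

lemma pow_image_inj:
  assumes "\<sigma> \<in> K" "\<sigma> \<noteq> {}" "k < p" "l < p" "(t ^^ k) ` \<sigma> = (t ^^ l) ` \<sigma>"
  shows "k = l"
proof -
  have *: "\<not> k < l" if "l < p" "(t ^^ k) ` \<sigma> = (t ^^ l) ` \<sigma>" for k l
  proof
    assume "k < l"
    have "(t ^^ (l - k)) ` (t ^^ k) ` \<sigma> = (t ^^ l) ` \<sigma>"
      using \<open>k < l\<close> by (simp add: image_comp flip: funpow_add)
    moreover have "\<not> p dvd l - k"
      using \<open>k < l\<close> \<open>l < p\<close> by (auto dest: dvd_imp_le)
    ultimately show False
      using free[of "l - k" "(t ^^ k) ` \<sigma>"] pow_image_in[OF assms(1)] assms(2) that by simp
  qed
  show ?thesis using *[of l k] *[of k l] assms by simp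
qed

text \<open>A choice that depends only on the orbit; \<open>R\<close> is the set of its fixed
  points. The \<open>p\<close> translates of a non-empty simplex are distinct by freeness, so
  exactly one of them is the chosen one.\<close>

lemma orbit_representatives:
  "\<exists>R. \<forall>\<sigma>\<in>K. \<sigma> \<noteq> {} \<longrightarrow> (\<exists>!k. k < p \<and> (t ^^ k) ` \<sigma> \<in> R)"
proof -
  define orb where "orb \<sigma> = range (\<lambda>k. (t ^^ k) ` \<sigma>)" for \<sigma>
  define rep where "rep \<sigma> = (SOME \<tau>. \<tau> \<in> orb \<sigma>)" for \<sigma>
  have orb_pow: "orb ((t ^^ k) ` \<sigma>) = orb \<sigma>" for k \<sigma>
  proof -
    have 1: "orb ((t ^^ l) ` \<tau>) \<subseteq> orb \<tau>" for l \<tau>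
      unfolding orb_def by (auto simp: image_comp simp flip: funpow_add)
    \<comment> \<open>The power \<open>k * (p - 1)\<close> undoes \<open>t ^^ k\<close>, which
      provides the reverse inclusion of orbits.\<close>
    have "(t ^^ (k * (p - 1))) ` (t ^^ k) ` \<sigma> = (t ^^ (k * (p - 1) + k)) ` \<sigma>"
      by (simp add: image_comp flip: funpow_add)
    also have "k * (p - 1) + k = k * p" using p_pos by (cases p) auto
    also have "(t ^^ (k * p)) ` \<sigma> = \<sigma>"
      using pow_image_mod[of "k * p" \<sigma>] by simp
    finally show ?thesis using 1[of k \<sigma>] 1[of "k * (p - 1)" "(t ^^ k) ` \<sigma>"] by simp
  qed
  have rep_pow: "rep ((t ^^ k) ` \<sigma>) = rep \<sigma>" for k \<sigma>
    unfolding rep_def orb_pow ..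
  have "\<exists>!k. k < p \<and> (t ^^ k) ` \<sigma> \<in> {\<sigma>. rep \<sigma> = \<sigma>}" if "\<sigma> \<in> K" "\<sigma> \<noteq> {}" for \<sigma>
  proof -
    have "rep \<sigma> \<in> orb \<sigma>"
      unfolding rep_def by (rule someI[of _ "(t ^^ 0) ` \<sigma>"]) (auto simp only: orb_def)
    then obtain k where k: "rep \<sigma> = (t ^^ k) ` \<sigma>" unfolding orb_def by auto
    show ?thesis
    proof (rule ex1I[of _ "k mod p"])
      show "k mod p < p \<and> (t ^^ (k mod p)) ` \<sigma> \<in> {\<sigma>. rep \<sigma> = \<sigma>}"
        using k p_pos by (simp add: pow_image_mod rep_pow)
    next
      fix l assume "l < p \<and> (t ^^ l) ` \<sigma> \<in> {\<sigma>. rep \<sigma> = \<sigma>}"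
      then show "l = k mod p"
        using k p_pos by (intro pow_image_inj[OF that]) (auto simp: rep_pow pow_image_mod)
    qed
  qed
  then show ?thesis by (intro exI[of _ "{\<sigma>. rep \<sigma> = \<sigma>}"] ballI impI)
qed

text \<open>The trace identity expressing that the chain groups are free, hence relatively projective:
  \<open>\<pi>\<close> is the restriction of chains to one simplex out of each orbit.\<close>

lemma trace_identity:
  "\<exists>\<pi>. (\<forall>j. \<forall>c\<in>simp_chains K j. \<pi> c \<in> simp_chains K j) \<and> (\<forall>c c'. \<pi> (c + c') = \<pi> c + \<pi> c') \<and>
     (\<forall>j. \<forall>c\<in>simp_chains K j. (\<Sum>k<p. (chain_act t ^^ (p - k)) (\<pi> ((chain_act t ^^ k) c))) = c)"
proof -
  obtain R where R: "\<forall>\<sigma>\<in>K. \<sigma> \<noteq> {} \<longrightarrow> (\<exists>!k. k < p \<and> (t ^^ k) ` \<sigma> \<in> R)"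
    using orbit_representatives ..
  define \<pi> :: "'a chain \<Rightarrow> 'a chain" where "\<pi> c = (\<lambda>w. if set w \<in> R then c w else 0)" for c
  show ?thesis
  proof (intro exI[of _ \<pi>] conjI allI ballI)
    show "\<pi> c \<in> simp_chains K j" if "c \<in> simp_chains K j" for j c
      using that aug_chains_if[of c K "Suc j" "\<lambda>\<sigma>. \<sigma> \<in> R"] by (simp add: simp_chains_eq \<pi>_def)
    show "\<pi> (c + c') = \<pi> c + \<pi> c'" for c c'
      unfolding \<pi>_def by auto
    fix j c assume c: "c \<in> simp_chains K j"
    show "(\<Sum>k<p. (chain_act t ^^ (p - k)) (\<pi> ((chain_act t ^^ k) c))) = c"
    proof
      fix w
      \<comment> \<open>The outer power undoes the inner one. What remains is the test made by
        \<pi>, now asked of the k-th translate of the simplex; it succeeds for exactly one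
        k.\<close>
      have "(chain_act t ^^ (p - k)) (\<pi> ((chain_act t ^^ k) c)) w = (if (t ^^ k) ` set w \<in> R then c w
        else 0)"
        if "k < p" for k
      proof -
        have "map (inv_into UNIV t ^^ k) (map (inv_into UNIV t ^^ (p - k)) w) = w"
          using that inv_t_pow by (simp flip: funpow_add)
        moreover have "set (map (inv_into UNIV t ^^ (p - k)) w) = (t ^^ k) ` set w"
          using that inv_t_pow_diff[of k] by simp
        ultimately show ?thesis
          unfolding \<pi>_def chain_act_pow by presburger
      qed
      then have "(\<Sum>k<p. (chain_act t ^^ (p - k)) (\<pi> ((chain_act t ^^ k) c))) w
          = (\<Sum>k<p. if (t ^^ k) ` set w \<in> R then c w else 0)"
        by (simp add: sum_fun_apply)
      also have "\<dots> = c w"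
      proof (cases "c w = 0")
        case False
        with c have "set w \<in> K" "set w \<noteq> {}"
          using aug_chainsD[of c K "Suc j" w] by (auto simp: simp_chains_eq)
        then have "\<exists>!k. k < p \<and> (t ^^ k) ` set w \<in> R"
          using R[rule_format] by simp
        then obtain k where k: "k < p \<and> (t ^^ k) ` set w \<in> R"
          and unique: "\<forall>l. l < p \<and> (t ^^ l) ` set w \<in> R \<longrightarrow> l = k"
          by (elim ex1E)
        have "{..<p} \<inter> {l. (t ^^ l) ` set w \<in> R} = {k}"
        proof (intro equalityI subsetI)
          fix l assume "l \<in> {..<p} \<inter> {l. (t ^^ l) ` set w \<in> R}"
          then have "l < p \<and> (t ^^ l) ` set w \<in> R" by simp
          with unique have "l = k" by (elim allE impE)
          then show "l \<in> {k}" by simp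
        next
          fix l assume "l \<in> {k}"
          then show "l \<in> {..<p} \<inter> {l. (t ^^ l) ` set w \<in> R}" using k by simp
        qed
        then show ?thesis by (simp add: sum.If_cases)
      qed (auto intro!: sum.neutral)
      finally show "(\<Sum>k<p. (chain_act t ^^ (p - k)) (\<pi> ((chain_act t ^^ k) c))) w = c w" .
    qed
  qed
qed

text \<open>The case \<open>q = 0\<close> is exactness over \<open>\<int>\<close>.\<close>

lemma exact_mod:
  fixes q :: int
  assumes \<phi>: "\<phi> \<in> simp_cochains K j"
    and ker: "\<And>c. c \<in> simp_chains K j \<Longrightarrow> q dvd \<phi> (smop p i (chain_act t) c)"
  obtains \<psi> where "\<psi> \<in> simp_cochains K j"
    "\<And>c. c \<in> simp_chains K j \<Longrightarrow> q dvd \<phi> c - \<psi> (smop p (Suc i) (chain_act t) c)"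
proof -
  let ?T = "chain_act t"
  obtain \<pi> where "(\<forall>j. \<forall>c\<in>simp_chains K j. \<pi> c \<in> simp_chains K j) \<and> (\<forall>c c'. \<pi> (c + c') = \<pi> c + \<pi> c') \<and>
     (\<forall>j. \<forall>c\<in>simp_chains K j. (\<Sum>k<p. (?T ^^ (p - k)) (\<pi> ((?T ^^ k) c))) = c)"
    using trace_identity ..
  then have \<pi>: "\<And>c. c \<in> simp_chains K j \<Longrightarrow> \<pi> c \<in> simp_chains K j"
    "\<And>c c'. \<pi> (c + c') = \<pi> c + \<pi> c'"
    "\<And>c. c \<in> simp_chains K j \<Longrightarrow> (\<Sum>k<p. (?T ^^ (p - k)) (\<pi> ((?T ^^ k) c))) = c"
    by simp_all
  \<comment> \<open>By the trace identity, \<phi> is the sum over k of \<open>\<rho> k\<close>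
    composed with the k-th power of the action.\<close>
  define \<rho> where "\<rho> k c = \<phi> ((?T ^^ (p - k)) (\<pi> c))" for k c
  have T_pow_add: "(?T ^^ k) (c + c') = (?T ^^ k) c + (?T ^^ k) c'" for k c c'
    by (rule ext) (simp add: chain_act_pow)
  have \<rho>_add: "\<rho> k (c + c') = \<rho> k c + \<rho> k c'"
    if "c \<in> simp_chains K j" "c' \<in> simp_chains K j" for k c c'
    using that unfolding \<rho>_def by (simp add: \<pi> T_pow_add eval_add[OF \<phi>] T_pow_chain)
  have \<rho>_sum: "(\<Sum>k<p. \<rho> k ((?T ^^ k) c)) = \<phi> c" if "c \<in> simp_chains K j" for c
  proof -
    have "(\<Sum>k<p. \<rho> k ((?T ^^ k) c)) = \<phi> (\<Sum>k<p. (?T ^^ (p - k)) (\<pi> ((?T ^^ k) c)))"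
      unfolding \<rho>_def using that by (intro eval_sum[OF \<phi>, symmetric] T_pow_chain \<pi>)
    then show ?thesis using that by (simp add: \<pi>)
  qed
  show thesis
  proof (cases "even i")
    case False
    \<comment> \<open>Here D_i is \<open>d\<close>, so \<phi> is invariant modulo \<open>q\<close>.
      The outer powers in \<rho> may then be dropped, and the trace identity turns into \<phi> = s
      \<psi> modulo \<open>q\<close> for \<psi> = \<phi> composed with \<pi>.\<close>
    have inv: "q dvd \<phi> c - \<phi> ((?T ^^ k) c)" if "c \<in> simp_chains K j" for c k
    proof (induction k)
      case (Suc k)
      have "q dvd \<phi> ((?T ^^ k) c) - \<phi> ((?T ^^ Suc k) c)"
        using ker[OF T_pow_chain[OF that, of k]] False T_pow_chain[OF that]
        by (simp add: smop_def dop_def eval_diff[OF \<phi>] T_chain)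
      with Suc show ?case by (metis dvd_add diff_add_cancel add_diff_eq)
    qed simp
    show thesis
    proof (rule that)
      let ?\<psi> = "cochain_of K j (\<lambda>c. \<phi> (\<pi> c))"
      show \<psi>: "?\<psi> \<in> simp_cochains K j"
        by (rule cochain_of_in) (simp add: \<pi> eval_add[OF \<phi>])
      fix c assume c: "c \<in> simp_chains K j"
      have "?\<psi> (smop p (Suc i) ?T c) = (\<Sum>k<p. \<phi> (\<pi> ((?T ^^ k) c)))"
        using False c by (simp add: smop_def sop_def eval_sum[OF \<psi>] T_pow_chain cochain_of_apply)
      moreover have "q dvd (\<Sum>k<p. \<phi> (\<pi> ((?T ^^ k) c)) - \<rho> k ((?T ^^ k) c))"
        unfolding \<rho>_def by (intro dvd_sum inv \<pi> T_pow_chain c)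
      ultimately show "q dvd \<phi> c - ?\<psi> (smop p (Suc i) ?T c)"
        using \<rho>_sum[OF c] by (simp add: sum_subtractf dvd_diff_commute)
    qed
  next
    case True
    show thesis
    proof (rule that)
      \<comment> \<open>Here D_i is \<open>s\<close>. The inner sums are the partial geometric sums
        1 + t + ... + t^(k-1), on which 1 - t telescopes: each k contributes \<open>\<rho> k\<close>
        after t^k, minus \<open>\<rho> k\<close> itself. The first kind adds up to \<phi>.\<close>
      let ?f = "\<lambda>c. - (\<Sum>k<p. \<Sum>l<k. \<rho> k ((?T ^^ l) c))"
      let ?\<psi> = "cochain_of K j ?f"
      show \<psi>: "?\<psi> \<in> simp_cochains K j"
        by (rule cochain_of_in) (simp add: T_pow_add \<rho>_add T_pow_chain sum.distrib)
      fix c assume c: "c \<in> simp_chains K j"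
      have "?\<psi> (smop p (Suc i) ?T c) = ?f c - ?f (?T c)"
        using True c by (simp add: smop_def dop_def eval_diff[OF \<psi>] T_chain cochain_of_apply)
      also have "\<dots> = (\<Sum>k<p. \<Sum>l<k. \<rho> k ((?T ^^ Suc l) c) - \<rho> k ((?T ^^ l) c))"
        by (simp add: sum_subtractf funpow_swap1)
      also have "\<dots> = (\<Sum>k<p. \<rho> k ((?T ^^ k) c) - \<rho> k c)"
        by (intro sum.cong refl, subst sum_lessThan_telescope) simp
      also have "\<dots> = \<phi> c - (\<Sum>k<p. \<rho> k c)"
        using \<rho>_sum[OF c] by (simp add: sum_subtractf)
      finally have eq: "\<phi> c - ?\<psi> (smop p (Suc i) ?T c) = (\<Sum>k<p. \<rho> k c)" by simp
      \<comment> \<open>The exponents \<open>p - k\<close> run through 1, ..., p, and t^p = 1 shifts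
        them to 0, ..., p - 1. The error term is thus \<phi> evaluated on \<open>s\<close> of a
        chain, which \<open>q\<close> divides by assumption.\<close>
      have "(\<Sum>k<p. \<rho> k c) = (\<Sum>k<p. \<phi> ((?T ^^ Suc k) (\<pi> c)))"
        unfolding \<rho>_def
        by (rule sum.reindex_bij_witness[of _ "\<lambda>k. p - Suc k" "\<lambda>k. p - Suc k"])
          (auto simp: Suc_diff_Suc)
      also have "\<dots> = (\<Sum>k<p. \<phi> ((?T ^^ k) (\<pi> c)))"
      proof -
        have "(\<Sum>k<p. \<phi> ((?T ^^ Suc k) (\<pi> c)) - \<phi> ((?T ^^ k) (\<pi> c))) = 0"
          by (subst sum_lessThan_telescope) (simp add: T_pow)
        then show ?thesis by (simp only: sum_subtractf)
      qed
      also have "\<dots> = \<phi> (smop p i ?T (\<pi> c))"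
        using True c by (simp add: smop_def sop_def eval_sum[OF \<phi>] T_pow_chain \<pi>)
      finally show "q dvd \<phi> c - ?\<psi> (smop p (Suc i) ?T c)"
        unfolding eq using ker \<pi> c by simp
    qed
  qed
qed

text \<open>The case \<open>q = 0\<close>, divisibility by 0 being equality with 0.\<close>

lemma exact:
  assumes \<phi>: "\<phi> \<in> simp_cochains K j" and "smop p i (cochain_act t) \<phi> = 0"
  obtains \<psi> where "\<psi> \<in> simp_cochains K j" "\<phi> = smop p (Suc i) (cochain_act t) \<psi>"
proof -
  have "0 dvd \<phi> (smop p i (chain_act t) c)" if "c \<in> simp_chains K j" for c
    using smop_eval[OF \<phi> that, of i] assms(2) by simp
  from exact_mod[OF \<phi> this] obtain \<psi> where \<psi>: "\<psi> \<in> simp_cochains K j"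
    "\<And>c. c \<in> simp_chains K j \<Longrightarrow> 0 dvd \<phi> c - \<psi> (smop p (Suc i) (chain_act t) c)" by blast
  have "\<phi> = smop p (Suc i) (cochain_act t) \<psi>"
    using \<psi> by (intro cochain_ext[OF \<phi> cochain_smop]) (auto simp: smop_eval)
  with \<psi>(1) that show thesis by blast
qed

section \<open>Existence and comparison of resolutions\<close>

lemma resolution_iff:
  "resolution p K t \<phi> \<longleftrightarrow> (\<forall>j. \<phi> j \<in> simp_cochains K j) \<and>
     smop p 0 (cochain_act t) (\<phi> 0) = unit_cochain K \<and>
     (\<forall>j. simp_coboundary K j (\<phi> j) = smop p (Suc j) (cochain_act t) (\<phi> (Suc j)))"
  unfolding resolution_def smop_def by (auto simp del: One_nat_def)

lemma cochain_act_unit: "cochain_act t (unit_cochain K) = unit_cochain K"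
proof (rule cochain_ext[where K = K and j = 0])
  fix c assume "c \<in> simp_chains K 0"
  then show "cochain_act t (unit_cochain K) c = unit_cochain K c"
    by (simp add: cochain_act_def unit_cochain_aug T_chain boundary_T) (simp add: chain_act_def)
qed (simp_all add: unit_cochain_in cochain_T)

text \<open>Exactness yields the next cochain once D_j kills the coboundary of the current one, so
  the recursion carries the invariant that D_j \<phi>_j is a cocycle. It persists because D_(j+1)
  \<phi>_(j+1) is itself a coboundary. The start is possible since the unit cochain is
  \<open>t\<close>-invariant and therefore in the image of \<open>s\<close>.\<close>

lemma resolution_exists: "\<exists>\<phi>. resolution p K t \<phi>"
proof -
  let ?D = "\<lambda>i. smop p i (cochain_act t)"
  let ?P = "\<lambda>j \<phi>. \<phi> \<in> simp_cochains K j \<and> simp_coboundary K j (?D j \<phi>) = 0 \<and>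
    (j = 0 \<longrightarrow> ?D 0 \<phi> = unit_cochain K)"
  let ?Q = "\<lambda>j \<phi> \<phi>'. simp_coboundary K j \<phi> = ?D (Suc j) \<phi>'"
  have "\<exists>\<phi>. \<forall>j. ?P j (\<phi> j) \<and> ?Q j (\<phi> j) (\<phi> (Suc j))"
  proof (rule dependent_nat_choice)
    have "?D 1 (unit_cochain K) = 0"
      by (simp add: smop_def dop_def cochain_act_unit)
    from exact[OF unit_cochain_in this] obtain \<psi>
      where "\<psi> \<in> simp_cochains K 0" "unit_cochain K = ?D (Suc 1) \<psi>" by blast
    then have "\<psi> \<in> simp_cochains K 0" "?D 0 \<psi> = unit_cochain K"
      by (auto simp: smop_def)
    then show "\<exists>\<phi>. ?P 0 \<phi>"
      by (intro exI[of _ \<psi>]) (simp add: coboundary_unit_cochain fin)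
  next
    fix \<phi> j assume P: "?P j \<phi>"
    have "?D (Suc (Suc j)) (simp_coboundary K j \<phi>) = 0"
      using P smop_coboundary[of \<phi> j j] by (simp add: smop_Suc_Suc)
    from exact[OF _ this] obtain \<phi>' where \<phi>': "\<phi>' \<in> simp_cochains K (Suc j)"
      "simp_coboundary K j \<phi> = ?D (Suc (Suc (Suc j))) \<phi>'"
      using P cochain_coboundary fin by metis
    then have eq: "simp_coboundary K j \<phi> = ?D (Suc j) \<phi>'"
      by (simp add: smop_Suc_Suc)
    then have "simp_coboundary K (Suc j) (?D (Suc j) \<phi>') = 0"
      using P simp_coboundary_coboundary fin by metis
    with \<phi>'(1) eq show "\<exists>\<phi>'. ?P (Suc j) \<phi>' \<and> ?Q j \<phi> \<phi>'" by blast
  qed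
  then show ?thesis unfolding resolution_iff by metis
qed

text \<open>A resolution of 0 modulo \<open>q\<close> has vanishing classes modulo \<open>q\<close>:
  the conclusion presents D \<theta> as the coboundary of D \<alpha>, and D \<alpha> automatically
  lies in the relevant kernel. It is applied to the difference of two resolutions, with
  \<open>q = 0\<close>, and in the join to the difference of \<chi> and u times a resolution on
  L.\<close>

lemma resolution_mod_zero:
  fixes q :: int
  assumes \<theta>: "\<And>j. \<theta> j \<in> simp_cochains K j"
    and zero: "\<And>c. c \<in> simp_chains K 0 \<Longrightarrow> q dvd \<theta> 0 (smop p 0 (chain_act t) c)"
    and step: "\<And>j c. c \<in> simp_chains K (Suc j) \<Longrightarrow>
      q dvd \<theta> j (aug_boundary K c) - \<theta> (Suc j) (smop p (Suc j) (chain_act t) c)"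
  shows "\<exists>\<alpha>\<in>simp_cochains K j. \<forall>c\<in>simp_chains K (Suc j).
    q dvd \<theta> (Suc j) (smop p (Suc j) (chain_act t) c) - \<alpha> (smop p (Suc j) (chain_act t)
      (aug_boundary K c))"
proof (induction j)
  case 0
  obtain \<alpha> where \<alpha>: "\<alpha> \<in> simp_cochains K 0"
    "\<And>c. c \<in> simp_chains K 0 \<Longrightarrow> q dvd \<theta> 0 c - \<alpha> (smop p (Suc 0) (chain_act t) c)"
    using exact_mod[OF \<theta> zero] by metis
  have "q dvd \<theta> 1 (smop p 1 (chain_act t) c) - \<alpha> (smop p 1 (chain_act t) (aug_boundary K c))"
    if "c \<in> simp_chains K (Suc 0)" for c
    using dvd_diff[OF \<alpha>(2)[OF aug_boundary_simp_chain[OF fin that]] step[OF that]] by simp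
  with \<alpha>(1) show ?case by (auto intro!: bexI[of _ \<alpha>])
next
  case (Suc j)
  then obtain \<alpha> where \<alpha>: "\<alpha> \<in> simp_cochains K j"
    "\<And>c. c \<in> simp_chains K (Suc j) \<Longrightarrow>
       q dvd \<theta> (Suc j) (smop p (Suc j) (chain_act t) c) - \<alpha> (smop p (Suc j) (chain_act t)
         (aug_boundary K c))"
    by blast
  \<comment> \<open>By induction hypothesis this corrected cochain is killed by D_(j+1) modulo
    \<open>q\<close>, hence lies in the image of D_(j+2) modulo \<open>q\<close>; the correction
    does not change its coboundary.\<close>
  define \<eta> where "\<eta> = \<theta> (Suc j) - simp_coboundary K j \<alpha>"
  have \<eta>: "\<eta> \<in> simp_cochains K (Suc j)"
    unfolding \<eta>_def using \<theta> \<alpha>(1) fin by (intro cochain_diff cochain_coboundary)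
  have \<eta>_apply: "\<eta> c = \<theta> (Suc j) c - \<alpha> (aug_boundary K c)" if "c \<in> simp_chains K (Suc j)" for c
    unfolding \<eta>_def using that by (simp add: simp_coboundary_apply)
  have "q dvd \<eta> (smop p (Suc j) (chain_act t) c)" if "c \<in> simp_chains K (Suc j)" for c
    using \<alpha>(2)[OF that] \<eta>_apply[OF smop_chain[OF that]] by (simp add: boundary_smop)
  from exact_mod[OF \<eta> this] obtain \<beta> where \<beta>: "\<beta> \<in> simp_cochains K (Suc j)"
    "\<And>c. c \<in> simp_chains K (Suc j) \<Longrightarrow> q dvd \<eta> c - \<beta> (smop p (Suc (Suc j)) (chain_act t) c)"
    by blast
  have "q dvd \<theta> (Suc (Suc j)) (smop p (Suc (Suc j)) (chain_act t) c)
      - \<beta> (smop p (Suc (Suc j)) (chain_act t) (aug_boundary K c))"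
    if c: "c \<in> simp_chains K (Suc (Suc j))" for c
  proof -
    have b: "aug_boundary K c \<in> simp_chains K (Suc j)"
      using c by (rule aug_boundary_simp_chain[OF fin])
    have "alternating c" using c aug_chains_alternating by (auto simp: simp_chains_eq)
    then have "\<eta> (aug_boundary K c) = \<theta> (Suc j) (aug_boundary K c)"
      using \<alpha>(1) by (simp add: \<eta>_apply[OF b] aug_boundary_boundary eval_0)
    with dvd_diff[OF \<beta>(2)[OF b] step[OF c]] show ?thesis by simp
  qed
  with \<beta>(1) show ?case by (intro bexI[of _ \<beta>] ballI)
qed

end

section \<open>Joins\<close>

fun lefts :: "('a + 'b) list \<Rightarrow> 'a list" where
  "lefts [] = []"
| "lefts (Inl a # w) = a # lefts w"
| "lefts (Inr b # w) = lefts w"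

fun rights :: "('a + 'b) list \<Rightarrow> 'b list" where
  "rights [] = []"
| "rights (Inl a # w) = rights w"
| "rights (Inr b # w) = b # rights w"

text \<open>The sign of the permutation moving the left vertices to the front.\<close>

fun jsign :: "('a + 'b) list \<Rightarrow> int" where
  "jsign [] = 1"
| "jsign (Inl a # w) = jsign w"
| "jsign (Inr b # w) = (-1) ^ length (lefts w) * jsign w"

text \<open>The join of two oriented simplices is oriented by concatenation. A general ordering is a
  shuffle, whose coefficient comes from its two sublists and the sign of the shuffle.\<close>

definition chain_join :: "'a chain \<Rightarrow> 'b chain \<Rightarrow> ('a + 'b) chain" where
  "chain_join c e = (\<lambda>w. jsign w * c (lefts w) * e (rights w))"

lemma lefts_append: "lefts (u @ w) = lefts u @ lefts w"
  by (induction u rule: lefts.induct) auto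

lemma rights_append: "rights (u @ w) = rights u @ rights w"
  by (induction u rule: lefts.induct) auto

lemma in_set_lefts: "a \<in> set (lefts w) \<longleftrightarrow> Inl a \<in> set w"
  by (induction w rule: lefts.induct) auto

lemma in_set_rights: "b \<in> set (rights w) \<longleftrightarrow> Inr b \<in> set w"
  by (induction w rule: lefts.induct) auto

lemma set_lefts_rights: "set w = set (lefts w) <+> set (rights w)"
proof -
  have "x \<in> set w \<longleftrightarrow> x \<in> set (lefts w) <+> set (rights w)" for x
    by (cases x) (auto simp: in_set_lefts in_set_rights)
  then show ?thesis by blast
qed

lemma distinct_lefts_rights: "distinct w \<longleftrightarrow> distinct (lefts w) \<and> distinct (rights w)"
  by (induction w rule: lefts.induct) (auto simp: in_set_lefts in_set_rights)

lemma length_lefts_rights: "length w = length (lefts w) + length (rights w)"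
  by (induction w rule: lefts.induct) auto

lemma lefts_map: "lefts (map (map_sum f g) w) = map f (lefts w)"
  by (induction w rule: lefts.induct) auto

lemma rights_map: "rights (map (map_sum f g) w) = map g (rights w)"
  by (induction w rule: lefts.induct) auto

lemma jsign_map: "jsign (map (map_sum f g) w) = jsign w"
  by (induction w rule: lefts.induct) (auto simp: lefts_map)

lemma jsign_swap_mixed:
  "jsign (xs @ Inl a # Inr b # ys) = - jsign (xs @ Inr b # Inl a # ys)"
  by (induction xs rule: lefts.induct) (auto simp: lefts_append)

lemma jsign_swap_same:
  "jsign (xs @ Inl a # Inl a' # ys) = jsign (xs @ Inl a' # Inl a # ys)"
  "jsign (xs @ Inr b # Inr b' # ys) = jsign (xs @ Inr b' # Inr b # ys)"
  by (induction xs rule: lefts.induct) (auto simp: lefts_append)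

text \<open>A swap inside one factor negates the coefficient of that factor and leaves
  \<open>jsign\<close> alone; a mixed swap changes only \<open>jsign\<close>.\<close>

lemma chain_join_chain:
  assumes c: "c \<in> aug_chains K m" and e: "e \<in> aug_chains L n"
  shows "chain_join c e \<in> aug_chains (complex_join K L) (m + n)"
proof -
  have "distinct w \<and> length w = m + n \<and> set w \<in> complex_join K L" if "chain_join c e w \<noteq> 0" for w
  proof -
    from that have "c (lefts w) \<noteq> 0" "e (rights w) \<noteq> 0" unfolding chain_join_def by auto
    note D = aug_chainsD[OF c this(1)] aug_chainsD[OF e this(2)]
    then have "set (lefts w) <+> set (rights w) \<in> complex_join K L"
      unfolding complex_join_def by blast
    with D show ?thesis
      using set_lefts_rights[of w] distinct_lefts_rights[of w] length_lefts_rights[of w] by simp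
  qed
  moreover have "alternating (chain_join c e)"
  proof (rule alternatingI)
    fix xs ys and x y :: "'a + 'b"
    note ac = alternatingD[OF aug_chains_alternating[OF c]]
    note ae = alternatingD[OF aug_chains_alternating[OF e]]
    show "chain_join c e (xs @ x # y # ys) = - chain_join c e (xs @ y # x # ys)"
    proof (cases x; cases y)
      fix a a' assume "x = Inl a" "y = Inl a'"
      then show ?thesis
        using ac[of "lefts xs" a a' "lefts ys"] jsign_swap_same(1)[of xs a a' ys]
        by (simp add: chain_join_def lefts_append rights_append)
    next
      fix b b' assume "x = Inr b" "y = Inr b'"
      then show ?thesis
        using ae[of "rights xs" b b' "rights ys"] jsign_swap_same(2)[of xs b b' ys]
        by (simp add: chain_join_def lefts_append rights_append)
    next
      fix a b assume "x = Inl a" "y = Inr b"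
      then show ?thesis
        using jsign_swap_mixed[of xs a b ys]
        by (simp add: chain_join_def lefts_append rights_append)
    next
      fix a b assume "x = Inr b" "y = Inl a"
      then show ?thesis
        using jsign_swap_mixed[of xs a b ys]
        by (simp add: chain_join_def lefts_append rights_append)
    qed
  qed
  ultimately show ?thesis
    unfolding aug_chains_def by blast
qed

lemma chain_join_add_left: "chain_join (c + c') e = chain_join c e + chain_join c' e"
  unfolding chain_join_def by (auto simp: algebra_simps)

lemma chain_join_diff_left: "chain_join (c - c') e = chain_join c e - chain_join c' e"
  unfolding chain_join_def by (auto simp: algebra_simps)

lemma chain_join_sum_left: "chain_join (\<Sum>i\<in>I. f i) e = (\<Sum>i\<in>I. chain_join (f i) e)"
  unfolding chain_join_def by (rule ext) (simp add: sum_fun_apply sum_distrib_left sum_distrib_right)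

lemma chain_join_add_right: "chain_join c (e + e') = chain_join c e + chain_join c e'"
  unfolding chain_join_def by (auto simp: algebra_simps)

lemma chain_join_diff_right: "chain_join c (e - e') = chain_join c e - chain_join c e'"
  unfolding chain_join_def by (auto simp: algebra_simps)

lemma chain_join_sum_right: "chain_join c (\<Sum>i\<in>I. f i) = (\<Sum>i\<in>I. chain_join c (f i))"
  unfolding chain_join_def by (rule ext) (simp add: sum_fun_apply sum_distrib_left)

lemma Union_complex_join:
  assumes "{} \<in> K" "{} \<in> L"
  shows "\<Union>(complex_join K L) = \<Union>K <+> \<Union>L"
proof
  show "\<Union>(complex_join K L) \<subseteq> \<Union>K <+> \<Union>L"
    unfolding complex_join_def by blast
  have "\<sigma> <+> {} \<in> complex_join K L" if "\<sigma> \<in> K" for \<sigma>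
    using that assms unfolding complex_join_def by blast
  moreover have "{} <+> \<tau> \<in> complex_join K L" if "\<tau> \<in> L" for \<tau>
    using that assms unfolding complex_join_def by blast
  ultimately show "\<Union>K <+> \<Union>L \<subseteq> \<Union>(complex_join K L)"
    by (auto simp: Plus_def)
qed

lemma complex_join_image: "complex_join K L = (\<lambda>(\<sigma>, \<tau>). \<sigma> <+> \<tau>) ` (K \<times> L)"
  unfolding complex_join_def by auto

lemma finite_complex_join:
  assumes "finite_complex K" "finite_complex L"
  shows "finite_complex (complex_join K L)"
proof -
  have "finite (complex_join K L)"
    using assms by (simp add: finite_complex_def complex_join_image)
  moreover have "{} \<in> complex_join K L"
    using assms unfolding complex_join_def finite_complex_def by (auto intro!: exI[of _ "{}"])
  moreover have "finite \<sigma>" if "\<sigma> \<in> complex_join K L" for \<sigma>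
    using that assms unfolding complex_join_def finite_complex_def by auto
  moreover have "\<tau> \<in> complex_join K L" if "\<sigma> \<in> complex_join K L" "\<tau> \<subseteq> \<sigma>" for \<sigma> \<tau>
  proof -
    obtain \<sigma>1 \<sigma>2 where s: "\<sigma>1 \<in> K" "\<sigma>2 \<in> L" "\<sigma> = \<sigma>1 <+> \<sigma>2"
      using \<open>\<sigma> \<in> complex_join K L\<close> unfolding complex_join_def by blast
    have "\<tau> = Inl -` \<tau> <+> Inr -` \<tau>"
    proof -
      have "x \<in> \<tau> \<longleftrightarrow> x \<in> Inl -` \<tau> <+> Inr -` \<tau>" for x by (cases x) auto
      then show ?thesis by blast
    qed
    moreover have "Inl -` \<tau> \<subseteq> \<sigma>1" "Inr -` \<tau> \<subseteq> \<sigma>2"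
      using \<open>\<tau> \<subseteq> \<sigma>\<close> s by auto
    then have "Inl -` \<tau> \<in> K" "Inr -` \<tau> \<in> L"
      using s finite_complexD(3) assms by metis+
    ultimately show ?thesis unfolding complex_join_def by blast
  qed
  ultimately show ?thesis unfolding finite_complex_def by blast
qed

text \<open>The Leibniz rule. A left vertex put in front is already in place, while a right vertex
  has to pass the \<open>m\<close> left vertices, whence the sign. With augmented boundaries the
  case \<open>m = 0\<close> is no exception.\<close>

lemma aug_boundary_join:
  assumes K: "finite_complex K" and L: "finite_complex L" and c: "c \<in> aug_chains K m"
  shows "aug_boundary (complex_join K L) (chain_join c e) =
    (\<lambda>w. chain_join (aug_boundary K c) e w + (-1) ^ m * chain_join c (aug_boundary L e) w)"
proof
  fix w
  have "aug_boundary (complex_join K L) (chain_join c e) w =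
    (\<Sum>v\<in>\<Union>K. chain_join c e (Inl v # w)) + (\<Sum>v\<in>\<Union>L. chain_join c e (Inr v # w))"
    using finite_complexD(1,2)[OF K] finite_complexD(1,2)[OF L]
    by (simp add: aug_boundary_def Union_complex_join sum.Plus comp_def)
  also have "(\<Sum>v\<in>\<Union>K. chain_join c e (Inl v # w)) = chain_join (aug_boundary K c) e w"
    by (simp add: chain_join_def aug_boundary_def sum_distrib_left sum_distrib_right)
  also have "(\<Sum>v\<in>\<Union>L. chain_join c e (Inr v # w)) = (-1) ^ m * chain_join c (aug_boundary L e) w"
  proof (cases "c (lefts w) = 0")
    case False
    then have "length (lefts w) = m" using aug_chainsD(2)[OF c] by blast
    then show ?thesis
      by (simp add: chain_join_def aug_boundary_def sum_distrib_left mult.assoc)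
  qed (simp add: chain_join_def)
  finally show "aug_boundary (complex_join K L) (chain_join c e) w =
    chain_join (aug_boundary K c) e w + (-1) ^ m * chain_join c (aug_boundary L e) w" .
qed

lemma chain_act_join:
  assumes "bij f" "bij g"
  shows "chain_act (map_sum f g) (chain_join c e) = chain_join (chain_act f c) (chain_act g e)"
proof -
  have "inv_into UNIV (map_sum f g) = map_sum (inv_into UNIV f) (inv_into UNIV g)"
  proof (rule inv_equality)
    show "map_sum (inv_into UNIV f) (inv_into UNIV g) (map_sum f g x) = x" for x
      using assms by (cases x) (auto simp: bij_is_inj)
    show "map_sum f g (map_sum (inv_into UNIV f) (inv_into UNIV g) y) = y" for y
      using assms by (cases y) (auto simp: bij_is_surj surj_f_inv_f)
  qed
  then show ?thesis
    unfolding chain_act_def chain_join_def by (simp add: lefts_map rights_map jsign_map)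
qed

lemma map_sum_pow: "map_sum f g ^^ k = map_sum (f ^^ k) (g ^^ k)" for f :: "'a \<Rightarrow> 'a" and g :: "'b \<Rightarrow> 'b"
proof
  show "(map_sum f g ^^ k) x = map_sum (f ^^ k) (g ^^ k) x" for x
    by (induction k; cases x) auto
qed

lemma map_sum_image_Plus: "map_sum f g ` (A <+> B) = f ` A <+> g ` B"
  unfolding Plus_def by (auto simp: image_Un image_image)

lemma Plus_eq_iff: "A <+> B = A' <+> B' \<longleftrightarrow> A = A' \<and> B = B'"
proof -
  have "A = {a. Inl a \<in> A <+> B}" "B = {b. Inr b \<in> A <+> B}" for A :: "'a set" and B :: "'b set"
    by auto
  then show ?thesis by metis
qed

text \<open>Freeness is inherited because an invariant simplex of the join has both parts invariant,
  hence both empty.\<close>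

lemma zp_complex_join:
  assumes "zp_complex p K f" "zp_complex p L g"
  shows "zp_complex p (complex_join K L) (map_sum f g)"
proof -
  have K: "finite_complex K" "f permutes \<Union>K" "(`) f ` K = K" "f ^^ p = id"
    and L: "finite_complex L" "g permutes \<Union>L" "(`) g ` L = L" "g ^^ p = id"
    using assms unfolding zp_complex_def by auto
  have bij: "bij (map_sum f g)"
  proof (rule o_bij)
    show "map_sum (inv_into UNIV f) (inv_into UNIV g) \<circ> map_sum f g = id"
      by (simp add: map_sum.comp permutes_inv_o[OF K(2)] permutes_inv_o[OF L(2)] sum.map_id0)
    show "map_sum f g \<circ> map_sum (inv_into UNIV f) (inv_into UNIV g) = id"
      by (simp add: map_sum.comp permutes_inv_o[OF K(2)] permutes_inv_o[OF L(2)] sum.map_id0)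
  qed
  have "map_sum f g permutes \<Union>(complex_join K L)"
  proof -
    have "map_sum f g x = x" if "x \<notin> \<Union>K <+> \<Union>L" for x
      using that permutes_not_in[OF K(2)] permutes_not_in[OF L(2)] by (cases x)
        (simp_all add: Plus_def image_iff)
    then show ?thesis
      using bij Union_complex_join[of K L] finite_complexD(2)[OF K(1)] finite_complexD(2)[OF L(1)]
      by (simp add: permutes_def bij_iff)
  qed
  moreover have "(`) (map_sum f g) ` complex_join K L = complex_join K L"
  proof -
    have "(`) (map_sum f g) ` complex_join K L =
        (\<lambda>(\<sigma>, \<tau>). \<sigma> <+> \<tau>) ` (map_prod ((`) f) ((`) g) ` (K \<times> L))"
      by (simp add: complex_join_image image_image split_def map_sum_image_Plus)
    then show ?thesis
      by (simp only: map_prod_surj_on[OF K(3) L(3)] complex_join_image)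
  qed
  moreover have "map_sum f g ^^ p = id"
    by (simp add: map_sum_pow K L sum.map_id0)
  moreover have "(map_sum f g ^^ k) ` \<sigma> \<noteq> \<sigma>"
    if prems: "\<not> p dvd k" "\<sigma> \<in> complex_join K L" "\<sigma> \<noteq> {}" for k \<sigma>
  proof
    assume "(map_sum f g ^^ k) ` \<sigma> = \<sigma>"
    moreover obtain \<sigma>1 \<sigma>2 where s: "\<sigma>1 \<in> K" "\<sigma>2 \<in> L" "\<sigma> = \<sigma>1 <+> \<sigma>2"
      using prems(2) unfolding complex_join_def by blast
    ultimately have "(f ^^ k) ` \<sigma>1 = \<sigma>1" "(g ^^ k) ` \<sigma>2 = \<sigma>2"
      by (simp_all add: map_sum_pow map_sum_image_Plus Plus_eq_iff)
    then show False
      using s prems assms unfolding zp_complex_def by (metis Plus_eq_empty_conv)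
  qed
  ultimately show ?thesis
    using finite_complex_join[OF K(1) L(1)] unfolding zp_complex_def by blast
qed

text \<open>The generator of the augmented chains in degree \<open>-1\<close>.\<close>

definition aug_unit :: "'a chain" where
  "aug_unit = (\<lambda>w. if w = [] then 1 else 0)"

lemma aug_unit_chain: "{} \<in> K \<Longrightarrow> aug_unit \<in> aug_chains K 0"
  unfolding aug_chains_def aug_unit_def alternating_def by auto

lemma aug_chain_0_eq: "e \<in> aug_chains K 0 \<Longrightarrow> e = (\<lambda>w. e [] * aug_unit w)"
  unfolding aug_chains_def aug_unit_def by fastforce

lemma aug_boundary_aug_unit: "aug_boundary K aug_unit = 0"
  unfolding aug_boundary_def aug_unit_def by auto

lemma chain_act_aug_unit: "chain_act t aug_unit = aug_unit"
  unfolding chain_act_def aug_unit_def by auto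

section \<open>Vanishing of classes modulo \<open>n\<close>\<close>

text \<open>An abstraction of the subcomplexes ker d and ker s, in which the description of
  cohomology modulo \<open>n\<close> by cosets of cosets is translated once into equations between
  functions.\<close>

locale int_complex =
  fixes C :: "nat \<Rightarrow> ('x \<Rightarrow> int) set" and D :: "nat \<Rightarrow> ('x \<Rightarrow> int) \<Rightarrow> ('x \<Rightarrow> int)"
  assumes C_0: "0 \<in> C i"
    and C_add: "\<phi> \<in> C i \<Longrightarrow> \<psi> \<in> C i \<Longrightarrow> \<phi> + \<psi> \<in> C i"
    and C_uminus: "\<phi> \<in> C i \<Longrightarrow> - \<phi> \<in> C i"
    and C_scale: "\<phi> \<in> C i \<Longrightarrow> (\<lambda>x. a * \<phi> x) \<in> C i"
    and D_in: "\<phi> \<in> C i \<Longrightarrow> D i \<phi> \<in> C (Suc i)"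
    and D_add: "\<phi> \<in> C i \<Longrightarrow> \<psi> \<in> C i \<Longrightarrow> D i (\<phi> + \<psi>) = D i \<phi> + D i \<psi>"
    and D_scale: "\<phi> \<in> C i \<Longrightarrow> D i (\<lambda>x. a * \<phi> x) = (\<lambda>x. a * D i \<phi> x)"
begin

lemma add_group_comm: "comm_group (add_group (C i))"
proof (rule comm_groupI)
  fix x assume "x \<in> carrier (add_group (C i))"
  then show "\<exists>y\<in>carrier (add_group (C i)). y \<otimes>\<^bsub>add_group (C i)\<^esub> x = \<one>\<^bsub>add_group (C i)\<^esub>"
    by (intro bexI[of _ "- x"]) (auto simp: add_group_def C_uminus)
qed (auto simp: add_group_def C_0 C_add algebra_simps)

lemma inv_add_group: "x \<in> C i \<Longrightarrow> inv\<^bsub>add_group (C i)\<^esub> x = - x"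
  using add_group_comm[of i] comm_group.axioms(2)
  by (intro group.inv_equality) (auto simp: add_group_def C_uminus)

lemma multiples_subgroup: "subgroup (multiples C n i) (add_group (C i))"
proof -
  interpret comm_group "add_group (C i)" by (rule add_group_comm)
  show ?thesis
  proof (rule subgroupI)
    show "multiples C n i \<subseteq> carrier (add_group (C i))"
      by (auto simp: multiples_def add_group_def C_scale)
    show "multiples C n i \<noteq> {}" using C_0 by (auto simp: multiples_def)
    fix a b assume "a \<in> multiples C n i"
    then obtain \<phi> where \<phi>: "\<phi> \<in> C i" "a = (\<lambda>x. int n * \<phi> x)" by (auto simp: multiples_def)
    have "inv\<^bsub>add_group (C i)\<^esub> a = - a"
      unfolding \<phi>(2) by (rule inv_add_group) (rule C_scale[OF \<phi>(1)])
    also have "\<dots> = (\<lambda>x. int n * (- \<phi>) x)" using \<phi> by auto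
    finally show "inv\<^bsub>add_group (C i)\<^esub> a \<in> multiples C n i"
      unfolding multiples_def by (intro image_eqI[where x = "- \<phi>"] C_uminus \<phi>(1)) simp
    assume "b \<in> multiples C n i"
    then obtain \<psi> where \<psi>: "\<psi> \<in> C i" "b = (\<lambda>x. int n * \<psi> x)" by (auto simp: multiples_def)
    have "a + b = (\<lambda>x. int n * (\<phi> + \<psi>) x)" using \<phi> \<psi> by (auto simp: algebra_simps)
    then show "a \<otimes>\<^bsub>add_group (C i)\<^esub> b \<in> multiples C n i"
      unfolding multiples_def by (intro image_eqI[OF _ C_add[OF \<phi>(1) \<psi>(1)]]) (simp add: add_group_def)
  qed
qed

lemma multiples_normal: "normal (multiples C n i) (add_group (C i))"
  by (intro comm_group.normal_iff_subgroup[THEN iffD2] add_group_comm multiples_subgroup)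

lemma mod_complex_group: "group (mod_complex C n i)"
  unfolding mod_complex_def using multiples_normal by (rule normal.factorgroup_is_group)

lemma mod_proj_add:
  assumes "x \<in> C i" "y \<in> C i"
  shows "mod_proj C n i x \<otimes>\<^bsub>mod_complex C n i\<^esub> mod_proj C n i y = mod_proj C n i (x + y)"
  using normal.rcos_sum[OF multiples_normal, of x i y n] assms
  by (simp add: mod_proj_def mod_complex_def FactGroup_def add_group_def)

lemma mod_proj_in: "x \<in> C i \<Longrightarrow> mod_proj C n i x \<in> carrier (mod_complex C n i)"
  by (auto simp: mod_proj_def mod_complex_def FactGroup_def RCOSETS_def add_group_def)

lemma carrier_mod_complex: "carrier (mod_complex C n i) = mod_proj C n i ` C i"
  by (auto simp: mod_proj_def mod_complex_def FactGroup_def RCOSETS_def add_group_def)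

lemma mod_proj_eq_iff:
  assumes "x \<in> C i" "y \<in> C i"
  shows "mod_proj C n i x = mod_proj C n i y \<longleftrightarrow> (\<exists>\<omega>\<in>C i. x = (\<lambda>c. y c + int n * \<omega> c))"
proof -
  interpret comm_group "add_group (C i)" by (rule add_group_comm)
  have "mod_proj C n i x = mod_proj C n i y \<longleftrightarrow> x \<in> mod_proj C n i y"
  proof
    show "mod_proj C n i x = mod_proj C n i y \<Longrightarrow> x \<in> mod_proj C n i y"
      using rcos_self[OF _ multiples_subgroup, of x n] assms by (simp add: mod_proj_def add_group_def)
    show "x \<in> mod_proj C n i y \<Longrightarrow> mod_proj C n i x = mod_proj C n i y"
      using repr_independence[OF _ _ multiples_subgroup, of x n y] assms
      by (simp add: mod_proj_def add_group_def)
  qed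
  also have "\<dots> \<longleftrightarrow> (\<exists>\<omega>\<in>C i. x = (\<lambda>c. y c + int n * \<omega> c))"
    by (auto simp: mod_proj_def r_coset_def multiples_def add_group_def plus_fun_def add.commute)
  finally show ?thesis .
qed

text \<open>\<open>mod_diff\<close> takes the only element of an image, which has to be a singleton:
  representatives differ by \<open>n\<close> times an element of \<open>C i\<close>, and
  \<open>D\<close> respects such multiples.\<close>

lemma mod_diff_proj:
  assumes "\<phi> \<in> C i"
  shows "mod_diff C D n i (mod_proj C n i \<phi>) = mod_proj C n (Suc i) (D i \<phi>)"
proof -
  have "(\<lambda>\<phi>. mod_proj C n (Suc i) (D i \<phi>)) ` mod_proj C n i \<phi> = {mod_proj C n (Suc i) (D i \<phi>)}"
  proof -
    have "mod_proj C n (Suc i) (D i \<psi>) = mod_proj C n (Suc i) (D i \<phi>)" if psi: "\<psi> \<in> mod_proj C n i \<phi>"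
      for \<psi>
    proof -
      obtain \<omega> where \<omega>: "\<omega> \<in> C i" "\<psi> = (\<lambda>x. int n * \<omega> x) + \<phi>"
        using psi by (auto simp: mod_proj_def r_coset_def multiples_def add_group_def)
      then have "D i \<psi> = (\<lambda>x. D i \<phi> x + int n * D i \<omega> x)"
        using assms by (auto simp: D_add D_scale C_scale)
      moreover have "\<psi> \<in> C i" using \<omega> assms by (simp only: C_add C_scale)
      ultimately show ?thesis
        using assms \<omega>(1) by (intro iffD2[OF mod_proj_eq_iff] D_in bexI[of _ "D i \<omega>"])
    qed
    moreover have "\<phi> \<in> mod_proj C n i \<phi>"
      using group.rcos_self[OF comm_group.axioms(2)[OF add_group_comm] _ multiples_subgroup, of \<phi> i n]
        assms
      by (simp add: mod_proj_def add_group_def)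
    ultimately show ?thesis by blast
  qed
  then show ?thesis by (simp add: mod_diff_def)
qed

lemma mod_coboundaries:
  "coboundaries (mod_complex C n) (mod_diff C D n) (Suc i) = (\<lambda>\<psi>. mod_proj C n (Suc i) (D i \<psi>)) ` C i"
  by (auto simp: coboundaries_def carrier_mod_complex mod_diff_proj image_image)

lemma mod_coboundaries_subgroup:
  "subgroup (coboundaries (mod_complex C n) (mod_diff C D n) (Suc i)) (mod_complex C n (Suc i))"
proof -
  let ?f = "\<lambda>\<psi>. mod_proj C n (Suc i) (D i \<psi>)"
  have "group_hom (add_group (C i)) (mod_complex C n (Suc i)) ?f"
  proof (intro group_hom.intro group_hom_axioms.intro homI)
    show "group (add_group (C i))" using add_group_comm by (rule comm_group.axioms)
    show "group (mod_complex C n (Suc i))" by (rule mod_complex_group)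
  qed (simp_all add: add_group_def mod_proj_in D_in D_add mod_proj_add)
  then have "subgroup (?f ` carrier (add_group (C i))) (mod_complex C n (Suc i))"
    by (rule group_hom.img_is_subgroup)
  then show ?thesis by (simp add: mod_coboundaries) (simp add: add_group_def)
qed

text \<open>Representatives of the integral class differ by some \<open>D i \<psi>\<close>, whose
  projection is a coboundary; so all of them have the same reduced class and \<open>the_elem\<close>
  in \<open>coeff_reduction\<close> returns it.\<close>

lemma coeff_reduction_class:
  assumes x: "x \<in> C (Suc i)"
  shows "coeff_reduction C D n (Suc i) (cohom_class (\<lambda>i. add_group (C i)) D (Suc i) x) =
    cohom_class (mod_complex C n) (mod_diff C D n) (Suc i) (mod_proj C n (Suc i) x)"
proof -
  let ?X = "cohom_class (\<lambda>i. add_group (C i)) D (Suc i) x"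
  let ?H = "coboundaries (mod_complex C n) (mod_diff C D n) (Suc i)"
  let ?M = "mod_complex C n (Suc i)"
  have X: "?X = (\<lambda>\<psi>. D i \<psi> + x) ` C i"
    by (auto simp: cohom_class_def coboundaries_def r_coset_def add_group_def)
  interpret group ?M by (rule mod_complex_group)
  have "?H #>\<^bsub>?M\<^esub> mod_proj C n (Suc i) (D i \<psi> + x) = ?H #>\<^bsub>?M\<^esub> mod_proj C n (Suc i) x" if "\<psi> \<in> C i" for \<psi>
  proof -
    have "mod_proj C n (Suc i) (D i \<psi>) \<in> ?H"
      using that by (simp add: mod_coboundaries)
    moreover have "mod_proj C n (Suc i) (D i \<psi> + x) =
        mod_proj C n (Suc i) (D i \<psi>) \<otimes>\<^bsub>?M\<^esub> mod_proj C n (Suc i) x"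
      using that x by (simp add: mod_proj_add D_in)
    ultimately show ?thesis
      using that x mod_coboundaries_subgroup[of n i]
      by (simp add: coset_mult_assoc[symmetric] coset_join2 mod_proj_in D_in subgroup.subset)
  qed
  then have const: "cohom_class (mod_complex C n) (mod_diff C D n) (Suc i) (mod_proj C n (Suc i) \<phi>) =
      cohom_class (mod_complex C n) (mod_diff C D n) (Suc i) (mod_proj C n (Suc i) x)" if "\<phi> \<in> ?X" for \<phi>
    using that unfolding X by (auto simp only: cohom_class_def)
  have "?X \<noteq> {}" unfolding X using C_0[of i] by blast
  then have "(\<lambda>\<phi>. cohom_class (mod_complex C n) (mod_diff C D n) (Suc i) (mod_proj C n (Suc i) \<phi>)) ` ?X =
    {cohom_class (mod_complex C n) (mod_diff C D n) (Suc i) (mod_proj C n (Suc i) x)}"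
    by (simp only: image_cong[OF refl const] image_constant_conv if_False)
  then show ?thesis unfolding coeff_reduction_def by simp
qed

text \<open>Both \<psi> and \<omega> are taken from \<open>C\<close>: coefficients are reduced in
  the subcomplex itself and not in the ambient cochains.\<close>

lemma coeff_reduction_eq_one_iff:
  assumes x: "x \<in> C (Suc i)"
  shows "coeff_reduction C D n (Suc i) (cohom_class (\<lambda>i. add_group (C i)) D (Suc i) x) =
      \<one>\<^bsub>cohom (mod_complex C n) (mod_diff C D n) (Suc i)\<^esub> \<longleftrightarrow>
    (\<exists>\<psi>\<in>C i. \<exists>\<omega>\<in>C (Suc i). x = (\<lambda>c. D i \<psi> c + int n * \<omega> c))"
proof -
  let ?H = "coboundaries (mod_complex C n) (mod_diff C D n) (Suc i)"
  let ?M = "mod_complex C n (Suc i)"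
  interpret group ?M by (rule mod_complex_group)
  have "coeff_reduction C D n (Suc i) (cohom_class (\<lambda>i. add_group (C i)) D (Suc i) x) =
      \<one>\<^bsub>cohom (mod_complex C n) (mod_diff C D n) (Suc i)\<^esub> \<longleftrightarrow> ?H #>\<^bsub>?M\<^esub> mod_proj C n (Suc i) x = ?H"
    unfolding coeff_reduction_class[OF x] by (simp add: cohom_class_def cohom_def FactGroup_def)
  also have "\<dots> \<longleftrightarrow> mod_proj C n (Suc i) x \<in> ?H"
    using coset_join1[OF _ mod_proj_in[OF x] mod_coboundaries_subgroup]
      coset_join2[OF mod_proj_in[OF x] mod_coboundaries_subgroup]
      subgroup.subset[OF mod_coboundaries_subgroup] by blast
  also have "\<dots> \<longleftrightarrow> (\<exists>\<psi>\<in>C i. mod_proj C n (Suc i) x = mod_proj C n (Suc i) (D i \<psi>))"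
    by (auto simp: mod_coboundaries)
  also have "\<dots> \<longleftrightarrow> (\<exists>\<psi>\<in>C i. \<exists>\<omega>\<in>C (Suc i). x = (\<lambda>c. D i \<psi> c + int n * \<omega> c))"
    using mod_proj_eq_iff[OF x D_in] by blast
  finally show ?thesis .
qed

lemma cohom_class_eqD:
  assumes "cohom_class (\<lambda>i. add_group (C i)) D (Suc i) x = cohom_class (\<lambda>i. add_group (C i)) D (Suc i) y"
  shows "\<exists>\<psi>\<in>C i. y = D i \<psi> + x"
proof -
  have X: "cohom_class (\<lambda>i. add_group (C i)) D (Suc i) z = (\<lambda>\<psi>. D i \<psi> + z) ` C i" for z
    by (auto simp: cohom_class_def coboundaries_def r_coset_def add_group_def)
  have "D i 0 + y \<in> (\<lambda>\<psi>. D i \<psi> + y) ` C i" using C_0 by blast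
  moreover have "D i 0 = 0" using D_add[of 0 i 0] C_0 by simp
  ultimately show ?thesis using assms unfolding X by auto
qed

end

section \<open>Smith classes and duals in terms of congruences on chains\<close>

context zp_cx
begin

lemma smith_complex_eq:
  "smith_complex p K t j i = {\<phi> \<in> simp_cochains K i. smop p (Suc j) (cochain_act t) \<phi> = 0}"
  unfolding smith_complex_def ker_d_def ker_s_def smop_def by auto

lemma smith_complex_eval:
  assumes "\<phi> \<in> smith_complex p K t j i" "c \<in> simp_chains K i"
  shows "\<phi> (smop p (Suc j) (chain_act t) c) = 0"
  using assms smop_eval[of \<phi> i c "Suc j"] by (simp add: smith_complex_eq)

lemma smith_complexI:
  assumes "\<phi> \<in> simp_cochains K i" "\<And>c. c \<in> simp_chains K i \<Longrightarrow> \<phi> (smop p (Suc j) (chain_act t) c) = 0"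
  shows "\<phi> \<in> smith_complex p K t j i"
  using assms
  by (auto simp: smith_complex_eq smop_eval intro!: cochain_ext[OF cochain_smop cochain_0])

lemma smop_in_smith_complex:
  "\<phi> \<in> simp_cochains K i \<Longrightarrow> smop p j (cochain_act t) \<phi> \<in> smith_complex p K t j i"
  by (simp add: smith_complex_eq cochain_smop smop_cochain_smop)

lemma smith_int_complex: "int_complex (smith_complex p K t j) (simp_coboundary K)"
proof
  fix i \<phi> \<psi> and a :: int
  show "0 \<in> smith_complex p K t j i"
    by (rule smith_complexI) (auto simp: cochain_0)
  assume \<phi>: "\<phi> \<in> smith_complex p K t j i"
  then have \<phi>': "\<phi> \<in> simp_cochains K i" by (simp add: smith_complex_eq)
  show "- \<phi> \<in> smith_complex p K t j i"
    using \<phi> \<phi>' by (intro smith_complexI cochain_uminus) (auto simp: smith_complex_eval)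
  show "(\<lambda>x. a * \<phi> x) \<in> smith_complex p K t j i"
    using \<phi> \<phi>' by (intro smith_complexI cochain_scale) (auto simp: smith_complex_eval)
  show "simp_coboundary K i \<phi> \<in> smith_complex p K t j (Suc i)"
    using \<phi> \<phi>' fin
    by (intro smith_complexI cochain_coboundary)
      (auto simp: smith_complex_eval simp_coboundary_apply smop_chain boundary_smop
        aug_boundary_simp_chain)
  show "simp_coboundary K i (\<lambda>x. a * \<phi> x) = (\<lambda>x. a * simp_coboundary K i \<phi> x)"
    by (auto simp: simp_coboundary_def)
  assume \<psi>: "\<psi> \<in> smith_complex p K t j i"
  then have \<psi>': "\<psi> \<in> simp_cochains K i" by (simp add: smith_complex_eq)
  show "\<phi> + \<psi> \<in> smith_complex p K t j i"
    using \<phi> \<phi>' \<psi> \<psi>' by (intro smith_complexI cochain_add) (auto simp: smith_complex_eval)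
  show "simp_coboundary K i (\<phi> + \<psi>) = simp_coboundary K i \<phi> + simp_coboundary K i \<psi>"
    by (rule simp_coboundary_add)
qed

lemma smith_class_resolution:
  obtains \<phi> where "resolution p K t \<phi>"
    "smith_class p K t j = smith_cohom_class p K t j (smop p j (cochain_act t) (\<phi> j))"
proof -
  have "resolution p K t (SOME \<phi>. resolution p K t \<phi>)"
    using resolution_exists by (rule someI_ex)
  then show thesis
    by (rule that) (simp add: smith_class_def Let_def smop_def)
qed

text \<open>The difference of two resolutions is a resolution of 0 over the integers, so the
  comparison lemma with \<open>q = 0\<close> applies.\<close>

lemma resolution_independent:
  assumes "resolution p K t \<phi>" "resolution p K t \<phi>'"
  shows "\<exists>\<alpha>\<in>simp_cochains K j. \<forall>c\<in>simp_chains K (Suc j).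
    \<phi> (Suc j) (smop p (Suc j) (chain_act t) c) - \<phi>' (Suc j) (smop p (Suc j) (chain_act t) c) =
      \<alpha> (smop p (Suc j) (chain_act t) (aug_boundary K c))"
proof -
  have R: "\<theta> j \<in> simp_cochains K j"
    "c \<in> simp_chains K 0 \<Longrightarrow> \<theta> 0 (smop p 0 (chain_act t) c) = unit_cochain K c"
    "c' \<in> simp_chains K (Suc j) \<Longrightarrow>
       \<theta> j (aug_boundary K c') = \<theta> (Suc j) (smop p (Suc j) (chain_act t) c')"
    if "resolution p K t \<theta>" for \<theta> j c c'
  proof -
    show 1: "\<theta> j \<in> simp_cochains K j" for j using that by (simp add: resolution_iff)
    show "c \<in> simp_chains K 0 \<Longrightarrow> \<theta> 0 (smop p 0 (chain_act t) c) = unit_cochain K c"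
      using that smop_eval[OF 1, of c 0 0] by (simp add: resolution_iff)
    show "c' \<in> simp_chains K (Suc j) \<Longrightarrow>
       \<theta> j (aug_boundary K c') = \<theta> (Suc j) (smop p (Suc j) (chain_act t) c')"
      using that smop_eval[OF 1, of c' "Suc j" "Suc j"] simp_coboundary_apply[of c' K j "\<theta> j"]
      by (simp add: resolution_iff)
  qed
  have "\<exists>\<alpha>\<in>simp_cochains K j. \<forall>c\<in>simp_chains K (Suc j).
    0 dvd (\<phi> (Suc j) - \<phi>' (Suc j)) (smop p (Suc j) (chain_act t) c) - \<alpha> (smop p (Suc j) (chain_act t)
      (aug_boundary K c))"
    by (rule resolution_mod_zero[where \<theta> = "\<lambda>j. \<phi> j - \<phi>' j"])
      (simp_all add: cochain_diff R[OF assms(1)] R[OF assms(2)])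
  then show ?thesis by simp
qed

lemma resolution_eval:
  assumes "resolution p K t \<phi>" "c \<in> simp_chains K (Suc j)"
  shows "\<phi> (Suc j) (smop p (Suc j) (chain_act t) c) = \<phi> j (aug_boundary K c)"
  using assms smop_eval[of "\<phi> (Suc j)" "Suc j" c "Suc j"] simp_coboundary_apply[of c K j "\<phi> j"]
  by (simp add: resolution_iff)

text \<open>The working criterion: any resolution may be used, \<psi> ranges over ker D_(i+2), and
  the congruence is tested on chains only. No quotient cochain has to be exhibited in the
  subcomplex, since division produces it.\<close>

lemma smith_nonzero_mod_iff:
  assumes \<phi>: "resolution p K t \<phi>"
  shows "smith_nonzero_mod p K t n (Suc i) \<longleftrightarrow>
    \<not> (\<exists>\<psi>\<in>smith_complex p K t (Suc i) i. \<forall>c\<in>simp_chains K (Suc i).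
      int n dvd \<phi> (Suc i) (smop p (Suc i) (chain_act t) c) - \<psi> (aug_boundary K c))"
    (is "_ \<longleftrightarrow> \<not> ?R")
proof -
  interpret int_complex "smith_complex p K t (Suc i)" "simp_coboundary K" by (rule smith_int_complex)
  obtain \<phi>0 where \<phi>0: "resolution p K t \<phi>0"
    "smith_class p K t (Suc i) = smith_cohom_class p K t (Suc i) (smop p (Suc i) (cochain_act t) (\<phi>0
      (Suc i)))"
    by (rule smith_class_resolution)
  have in0: "\<phi>0 (Suc i) \<in> simp_cochains K (Suc i)" using \<phi>0(1) by (simp add: resolution_iff)
  define x where "x = smop p (Suc i) (cochain_act t) (\<phi>0 (Suc i))"
  have x: "x \<in> smith_complex p K t (Suc i) (Suc i)"
    unfolding x_def using in0 by (rule smop_in_smith_complex)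
  then have x': "x \<in> simp_cochains K (Suc i)" by (simp add: smith_complex_eq)
  have x_apply: "x c = \<phi>0 (Suc i) (smop p (Suc i) (chain_act t) c)" if "c \<in> simp_chains K (Suc i)" for c
    unfolding x_def using in0 that by (rule smop_eval)
  have "\<not> smith_nonzero_mod p K t n (Suc i) \<longleftrightarrow>
      (\<exists>\<psi>\<in>smith_complex p K t (Suc i) i. \<exists>\<omega>\<in>smith_complex p K t (Suc i) (Suc i).
        x = (\<lambda>c. simp_coboundary K i \<psi> c + int n * \<omega> c))"
    using coeff_reduction_eq_one_iff[OF x, of n]
    by (simp add: smith_nonzero_mod_def smith_class_mod_def smith_cohom_mod_def \<phi>0(2)
      smith_cohom_class_def x_def)
  also have "\<dots> \<longleftrightarrow> (\<exists>\<psi>\<in>smith_complex p K t (Suc i) i. \<forall>c\<in>simp_chains K (Suc i).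
      int n dvd x c - \<psi> (aug_boundary K c))"
  proof (rule bex_cong[OF refl])
    fix \<psi> assume \<psi>: "\<psi> \<in> smith_complex p K t (Suc i) i"
    define \<eta> where "\<eta> = x - simp_coboundary K i \<psi>"
    have \<eta>: "\<eta> \<in> smith_complex p K t (Suc i) (Suc i)"
      using C_add[OF x C_uminus[OF D_in[OF \<psi>]]] by (simp add: \<eta>_def)
    then have \<eta>': "\<eta> \<in> simp_cochains K (Suc i)" by (simp add: smith_complex_eq)
    have \<eta>_apply: "\<eta> c = x c - \<psi> (aug_boundary K c)" if "c \<in> simp_chains K (Suc i)" for c
      using that by (simp add: \<eta>_def simp_coboundary_apply)
    show "(\<exists>\<omega>\<in>smith_complex p K t (Suc i) (Suc i). x = (\<lambda>c. simp_coboundary K i \<psi> c + int n * \<omega> c)) \<longleftrightarrow>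
      (\<forall>c\<in>simp_chains K (Suc i). int n dvd x c - \<psi> (aug_boundary K c))"
    proof
      assume "\<exists>\<omega>\<in>smith_complex p K t (Suc i) (Suc i). x = (\<lambda>c. simp_coboundary K i \<psi> c + int n * \<omega> c)"
      then show "\<forall>c\<in>simp_chains K (Suc i). int n dvd x c - \<psi> (aug_boundary K c)"
        by (auto simp: simp_coboundary_apply)
    next
      assume "\<forall>c\<in>simp_chains K (Suc i). int n dvd x c - \<psi> (aug_boundary K c)"
      then have dvd: "int n dvd \<eta> c" if "c \<in> simp_chains K (Suc i)" for c
        using that \<eta>_apply by simp
      have dvd': "int n dvd \<eta> c" for c
        using dvd cochain_outside[OF \<eta>', of c] by (cases "c \<in> simp_chains K (Suc i)") simp_all
      \<comment> \<open>The quotient stays in the subcomplex, because the kernel condition says that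
        certain values are 0, and 0 divided by \<open>n\<close> is 0.\<close>
      let ?\<omega> = "\<lambda>c. \<eta> c div int n"
      have "?\<omega> \<in> smith_complex p K t (Suc i) (Suc i)"
      proof (rule smith_complexI)
        show "?\<omega> \<in> simp_cochains K (Suc i)"
          by (rule simp_cochainsI)
            (simp_all add: eval_add[OF \<eta>'] cochain_outside[OF \<eta>'] dvd' div_plus_div_distrib_dvd_left)
      qed (simp add: smith_complex_eval[OF \<eta>])
      moreover have "x = (\<lambda>c. simp_coboundary K i \<psi> c + int n * ?\<omega> c)"
      proof
        fix c
        have "int n * ?\<omega> c = \<eta> c" using dvd' by simp
        then show "x c = simp_coboundary K i \<psi> c + int n * ?\<omega> c" by (simp add: \<eta>_def)
      qed
      ultimately show "\<exists>\<omega>\<in>smith_complex p K t (Suc i) (Suc i). x = (\<lambda>c. simp_coboundary K i \<psi> c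
        + int n * \<omega> c)"
        by (intro bexI[where x = ?\<omega>])
    qed
  qed
  also have "\<dots> \<longleftrightarrow> ?R"
  proof -
    obtain \<alpha> where \<alpha>: "\<alpha> \<in> simp_cochains K i"
      and diff: "\<forall>c\<in>simp_chains K (Suc i).
        \<phi>0 (Suc i) (smop p (Suc i) (chain_act t) c) - \<phi> (Suc i) (smop p (Suc i) (chain_act t) c) =
          \<alpha> (smop p (Suc i) (chain_act t) (aug_boundary K c))"
      using resolution_independent[OF \<phi>0(1) \<phi>, of i] by blast
    \<comment> \<open>Changing the resolution changes the cocycle by the coboundary of \<beta>; as
      \<beta> lies in the subcomplex, it is absorbed into \<psi>.\<close>
    define \<beta> where "\<beta> = smop p (Suc i) (cochain_act t) \<alpha>"
    have \<beta>: "\<beta> \<in> smith_complex p K t (Suc i) i"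
      unfolding \<beta>_def using \<alpha> by (rule smop_in_smith_complex)
    have eq: "x c = \<phi> (Suc i) (smop p (Suc i) (chain_act t) c) + \<beta> (aug_boundary K c)"
      if "c \<in> simp_chains K (Suc i)" for c
      using diff[rule_format, OF that] smop_eval[OF \<alpha> aug_boundary_simp_chain[OF fin that], of "Suc i"]
      unfolding x_apply[OF that] \<beta>_def by linarith
    show ?thesis
    proof
      assume "\<exists>\<psi>\<in>smith_complex p K t (Suc i) i. \<forall>c\<in>simp_chains K (Suc i). int n dvd x c - \<psi>
        (aug_boundary K c)"
      then obtain \<psi> where "\<psi> \<in> smith_complex p K t (Suc i) i"
        "\<forall>c\<in>simp_chains K (Suc i). int n dvd x c - \<psi> (aug_boundary K c)" by blast
      then show ?R
        using C_add[OF _ C_uminus[OF \<beta>], of \<psi>]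
        by (intro bexI[of _ "\<psi> + - \<beta>"]) (auto simp: eq algebra_simps)
    next
      assume ?R
      then obtain \<psi> where "\<psi> \<in> smith_complex p K t (Suc i) i"
        "\<forall>c\<in>simp_chains K (Suc i). int n dvd \<phi> (Suc i) (smop p (Suc i) (chain_act t) c) - \<psi>
          (aug_boundary K c)"
        by blast
      then show "\<exists>\<psi>\<in>smith_complex p K t (Suc i) i. \<forall>c\<in>simp_chains K (Suc i). int n dvd x c - \<psi>
        (aug_boundary K c)"
        using C_add[OF _ \<beta>, of \<psi>]
        by (intro bexI[of _ "\<psi> + \<beta>"]) (auto simp: eq algebra_simps)
    qed
  qed
  finally show ?thesis by blast
qed

text \<open>A dual comes with some cochain representing the Smith class, whereas the join needs the
  value of a prescribed resolution. Two representing cocycles differ by the coboundary of an element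
  of ker d = im s, hence at \<open>c\<close> by some \<alpha> (s \<partial> c), which
  \<open>p\<close> divides by the definition of a dual. As \<open>Suc i\<close> is even, D_(i+1) is
  \<open>s\<close> throughout.\<close>

lemma smith_dual_eval:
  assumes dual: "smith_dual p K t (Suc i) c" and even: "odd i" and \<phi>: "resolution p K t \<phi>"
  shows "c \<in> simp_chains K (Suc i)" "\<not> int p dvd \<phi> (Suc i) (smop p (Suc i) (chain_act t) c)"
proof -
  interpret int_complex "smith_complex p K t (Suc i)" "simp_coboundary K" by (rule smith_int_complex)
  show c: "c \<in> simp_chains K (Suc i)" using dual by (simp add: smith_dual_def)
  obtain \<phi>' where \<phi>': "\<phi>' \<in> simp_cochains K (Suc i)"
    "smith_class p K t (Suc i) = smith_cohom_class p K t (Suc i) (smop p (Suc i) (cochain_act t) \<phi>')"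
    "chain_cong_0 (smop p (Suc i) (chain_act t) (simp_boundary K c)) p"
    "\<not> int p dvd \<phi>' (smop p (Suc i) (chain_act t) c)"
    using dual even unfolding smith_dual_def smop_def by auto
  obtain \<phi>0 where \<phi>0: "resolution p K t \<phi>0"
    "smith_class p K t (Suc i) = smith_cohom_class p K t (Suc i) (smop p (Suc i) (cochain_act t) (\<phi>0
      (Suc i)))"
    by (rule smith_class_resolution)
  have in0: "\<phi>0 (Suc i) \<in> simp_cochains K (Suc i)" using \<phi>0(1) by (simp add: resolution_iff)
  let ?D = "smop p (Suc i)"
  have b: "aug_boundary K c \<in> simp_chains K i" using aug_boundary_simp_chain[OF fin c] .
  have dvd: "int p dvd \<alpha> (?D (chain_act t) (aug_boundary K c))" if "\<alpha> \<in> simp_cochains K i" for \<alpha>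
    using eval_dvd[OF that smop_chain[OF b]] \<phi>'(3) by (simp add: chain_cong_0_def simp_boundary_eq[OF c])
  obtain \<psi> where \<psi>: "\<psi> \<in> smith_complex p K t (Suc i) i"
    "?D (cochain_act t) (\<phi>0 (Suc i)) = simp_coboundary K i \<psi> + ?D (cochain_act t) \<phi>'"
    using cohom_class_eqD \<phi>0(2) \<phi>'(2) unfolding smith_cohom_class_def by metis
  then obtain \<alpha> where \<alpha>: "\<alpha> \<in> simp_cochains K i" "\<psi> = smop p (Suc (Suc (Suc i))) (cochain_act t) \<alpha>"
    using exact[of \<psi> i "Suc (Suc i)"] unfolding smith_complex_eq by blast
  have "?D (cochain_act t) (\<phi>0 (Suc i)) c = \<psi> (aug_boundary K c) + ?D (cochain_act t) \<phi>' c"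
    using c by (simp add: \<psi>(2) simp_coboundary_apply)
  then have "\<phi>0 (Suc i) (?D (chain_act t) c) = \<alpha> (?D (chain_act t) (aug_boundary K c)) + \<phi>' (?D
    (chain_act t) c)"
    using c b \<alpha> by (simp add: smop_eval[OF in0] smop_eval[OF \<phi>'(1)] smop_eval smop_Suc_Suc)
  moreover obtain \<beta> where "\<beta> \<in> simp_cochains K i"
    "\<phi>0 (Suc i) (?D (chain_act t) c) - \<phi> (Suc i) (?D (chain_act t) c) = \<beta> (?D (chain_act t)
      (aug_boundary K c))"
    using resolution_independent[OF \<phi>0(1) \<phi>, of i] c by blast
  ultimately have "\<phi>' (?D (chain_act t) c) = \<phi> (Suc i) (?D (chain_act t) c)
      + (\<beta> (?D (chain_act t) (aug_boundary K c)) - \<alpha> (?D (chain_act t) (aug_boundary K c)))"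
    "int p dvd \<beta> (?D (chain_act t) (aug_boundary K c)) - \<alpha> (?D (chain_act t) (aug_boundary K c))"
    using dvd \<alpha>(1) by (simp_all add: dvd_diff)
  then show "\<not> int p dvd \<phi> (Suc i) (smop p (Suc i) (chain_act t) c)"
    using \<phi>'(4) by (metis dvd_add)
qed

end

section \<open>Duality modulo 2\<close>

text \<open>(-1) to the number of inversions with respect to \<open>f\<close>: for injective
  \<open>f\<close>, the sign of the permutation sorting the list.\<close>

fun perm_sign :: "('a \<Rightarrow> nat) \<Rightarrow> 'a list \<Rightarrow> int" where
  "perm_sign f [] = 1"
| "perm_sign f (x # w) = (-1) ^ length (filter (\<lambda>y. f y < f x) w) * perm_sign f w"

lemma perm_sign_swap:
  assumes "f x \<noteq> f y"
  shows "perm_sign f (xs @ x # y # ys) = - perm_sign f (xs @ y # x # ys)"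
proof (induction xs)
  case Nil
  show ?case using assms by (cases "f x < f y") auto
next
  case (Cons a xs)
  then show ?case by simp
qed

lemma perm_sign_square: "perm_sign f w * perm_sign f w = 1"
  by (induction w) (auto simp: mult.assoc mult.left_commute[of _ "perm_sign f w"
    for w] simp flip: power_mult_distrib)

text \<open>Adjacent swaps carry the required entry to its place, one position at a time; entries
  already matched are collected in the prefix \<open>u\<close>.\<close>

lemma swap_invariant_mset:
  assumes swap: "\<And>xs x y ys. h (xs @ x # y # ys) = h (xs @ y # x # ys)"
    and "mset v = mset w"
  shows "h v = h w"
proof -
  have move: "h (u @ as @ x # bs) = h (u @ x # as @ bs)" for u as x bs
  proof (induction as arbitrary: bs rule: rev_induct)
    case (snoc a as)
    have "h (u @ (as @ [a]) @ x # bs) = h (u @ as @ x # a # bs)"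
      using swap[of "u @ as" a x bs] by simp
    then show ?case using snoc[of "a # bs"] by simp
  qed simp
  have "h (u @ v) = h (u @ w)" for u
    using assms(2)
  proof (induction v arbitrary: u w)
    case (Cons x v)
    then have "x \<in> set w" by (metis list.set_intros(1) set_mset_mset)
    then obtain as bs where w: "w = as @ x # bs" by (meson split_list)
    have "h ((u @ [x]) @ v) = h ((u @ [x]) @ as @ bs)"
      using Cons.prems w by (intro Cons.IH) simp
    then show ?case using move[of u as x bs] w by simp
  qed simp
  from this[of "[]"] show ?thesis by simp
qed

text \<open>\<open>g\<close> is the simplex \<sigma> with the orientation given by the ordering
  \<open>w\<close>; an alternating function is determined on all orderings of \<sigma> by its value
  at \<open>w\<close>.\<close>

lemma elementary_chain:
  assumes "finite_complex K" "\<sigma> \<in> K" "card \<sigma> = n"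
  shows "\<exists>w g. g \<in> aug_chains K n \<and>
    (\<forall>c\<in>aug_chains K n. \<forall>v. (if set v = \<sigma> then c v else 0) = c w * g v)"
proof -
  have fin: "finite \<sigma>" using assms(1,2) unfolding finite_complex_def by blast
  obtain w where w: "distinct w" "set w = \<sigma>" using finite_distinct_list[OF fin] by blast
  obtain f :: "'a \<Rightarrow> nat" where f: "inj_on f \<sigma>"
    using finite_imp_inj_to_nat_seg[OF fin] by blast
  define s where "s v = (if distinct v \<and> set v = \<sigma> then perm_sign f v else 0)" for v
  \<comment> \<open>The factor \<open>s w\<close> normalises \<open>g w\<close> to 1, whatever the
    numbering \<open>f\<close> of the vertices.\<close>
  define g where "g v = s w * s v" for v
  have s_swap: "s (xs @ x # y # ys) = - s (xs @ y # x # ys)" for xs x y ys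
  proof (cases "distinct (xs @ x # y # ys) \<and> set (xs @ x # y # ys) = \<sigma>")
    case True
    then have "f x \<noteq> f y" using inj_onD[OF f, of x y] by auto
    moreover have "distinct (xs @ y # x # ys) \<and> set (xs @ y # x # ys) = \<sigma>"
      using True by (auto simp: insert_commute)
    ultimately show ?thesis using True perm_sign_swap[of f x y xs ys] by (simp add: s_def)
  next
    case False
    then have "\<not> (distinct (xs @ y # x # ys) \<and> set (xs @ y # x # ys) = \<sigma>)"
      by (auto simp: insert_commute)
    then show ?thesis using False by (simp only: s_def if_False)
  qed
  have "g \<in> aug_chains K n"
  proof -
    have "alternating g"
    proof (rule alternatingI)
      fix xs ys and x y :: 'a
      show "g (xs @ x # y # ys) = - g (xs @ y # x # ys)"
        using s_swap[of xs x y ys] by (simp add: g_def)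
    qed
    moreover have "distinct v \<and> length v = n \<and> set v \<in> K" if "g v \<noteq> 0" for v
    proof -
      have "distinct v \<and> set v = \<sigma>" using that by (auto simp: g_def s_def split: if_splits)
      then show ?thesis using assms(2,3) distinct_card[of v] by simp
    qed
    ultimately show ?thesis unfolding aug_chains_def by blast
  qed
  moreover have "(if set v = \<sigma> then c v else 0) = c w * g v" if c: "c \<in> aug_chains K n" for c v
  proof (cases "set v = \<sigma> \<and> distinct v")
    case True
    then have mset: "mset v = mset w" using w set_eq_iff_mset_eq_distinct by metis
    have swap: "s (xs @ x # y # ys) * c (xs @ x # y # ys) = s (xs @ y # x # ys) * c (xs @ y # x # ys)"
      for xs x y ys
      using s_swap[of xs x y ys] alternatingD[OF aug_chains_alternating[OF c], of xs x y ys] by simp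
    \<comment> \<open>A product of two alternating functions is unchanged by swaps, hence constant
      on the orderings of \<sigma>.\<close>
    have eq: "s v * c v = s w * c w"
      by (rule swap_invariant_mset[where h = "\<lambda>v. s v * c v", OF swap mset])
    have "s v * s v = 1" using True by (simp add: s_def perm_sign_square)
    then have "c v = s v * (s v * c v)" by (simp flip: mult.assoc)
    then show ?thesis unfolding eq using True by (simp add: g_def mult_ac)
  next
    case False
    then show ?thesis using aug_chainsD(1)[OF c, of v] by (auto simp: g_def s_def)
  qed
  ultimately show ?thesis by (intro exI[of _ w] exI[of _ g] conjI ballI allI)
qed

text \<open>The simplices with \<open>j + 1\<close> vertices, each with a fixed orientation, form a
  basis of the chains; \<open>g'\<close> is the dual basis, reading off the coefficient at the fixed
  ordering.\<close>

lemma chain_basis: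
  assumes K: "finite_complex K"
  shows "\<exists>(S :: 'a set set) g (g' :: 'a set \<Rightarrow> 'a cochain). finite S \<and>
    (\<forall>\<sigma>\<in>S. g \<sigma> \<in> simp_chains K j) \<and> (\<forall>\<sigma>. g' \<sigma> \<in> simp_cochains K j) \<and>
    (\<forall>\<phi>\<in>simp_cochains K j. \<phi> = (\<Sum>\<sigma>\<in>S. (\<lambda>c. \<phi> (g \<sigma>) * g' \<sigma> c)))"
proof -
  let ?S = "{\<sigma> \<in> K. card \<sigma> = Suc j}"
  have "\<forall>\<sigma>\<in>?S. \<exists>q. snd q \<in> aug_chains K (Suc j) \<and>
      (\<forall>c\<in>aug_chains K (Suc j). \<forall>v. (if set v = \<sigma> then c v else 0) = c (fst q) * snd q v)"
  proof
    fix \<sigma> assume "\<sigma> \<in> ?S"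
    then have \<sigma>: "\<sigma> \<in> K" "card \<sigma> = Suc j" by auto
    from elementary_chain[OF K \<sigma>] obtain w g where "g \<in> aug_chains K (Suc j)"
      "\<forall>c\<in>aug_chains K (Suc j). \<forall>v. (if set v = \<sigma> then c v else 0) = c w * g v"
      by (elim exE conjE)
    then show "\<exists>q. snd q \<in> aug_chains K (Suc j) \<and>
      (\<forall>c\<in>aug_chains K (Suc j). \<forall>v. (if set v = \<sigma> then c v else 0) = c (fst q) * snd q v)"
      by (intro exI[of _ "(w, g)"]) simp
  qed
  then have "\<exists>q. \<forall>\<sigma>\<in>?S. snd (q \<sigma>) \<in> aug_chains K (Suc j) \<and>
      (\<forall>c\<in>aug_chains K (Suc j). \<forall>v. (if set v = \<sigma> then c v else 0) = c (fst (q \<sigma>)) * snd (q \<sigma>) v)"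
    by (rule bchoice)
  then obtain q where q: "\<forall>\<sigma>\<in>?S. snd (q \<sigma>) \<in> aug_chains K (Suc j) \<and>
      (\<forall>c\<in>aug_chains K (Suc j). \<forall>v. (if set v = \<sigma> then c v else 0) = c (fst (q \<sigma>)) * snd (q \<sigma>) v)" ..
  define w where "w \<sigma> = fst (q \<sigma>)" for \<sigma>
  define g where "g \<sigma> = snd (q \<sigma>)" for \<sigma>
  note wg = q[folded w_def g_def]
  define g' where "g' \<sigma> = cochain_of K j (\<lambda>c. c (w \<sigma>))" for \<sigma>
  have fin: "finite ?S" using K unfolding finite_complex_def by auto
  have g: "g \<sigma> \<in> simp_chains K j" if "\<sigma> \<in> ?S" for \<sigma> using wg that by (simp add: simp_chains_eq)
  have g': "g' \<sigma> \<in> simp_cochains K j" for \<sigma> unfolding g'_def by (rule cochain_of_in) simp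
  have expand: "c = (\<Sum>\<sigma>\<in>?S. (\<lambda>v. c (w \<sigma>) * g \<sigma> v))" if c: "c \<in> simp_chains K j" for c
  proof
    fix v
    have "(\<Sum>\<sigma>\<in>?S. (\<lambda>v. c (w \<sigma>) * g \<sigma> v)) v = (\<Sum>\<sigma>\<in>?S. if set v = \<sigma> then c v else 0)"
      unfolding sum_fun_apply using wg c by (intro sum.cong) (simp_all add: simp_chains_eq)
    also have "\<dots> = c v"
    proof (cases "c v = 0")
      case False
      then have "set v \<in> ?S"
        using aug_chainsD[of c K "Suc j" v] c distinct_card[of v] by (simp add: simp_chains_eq)
      then show ?thesis using fin by simp
    qed (auto intro!: sum.neutral)
    finally show "c v = (\<Sum>\<sigma>\<in>?S. (\<lambda>v. c (w \<sigma>) * g \<sigma> v)) v" by simp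
  qed
  have "\<phi> = (\<Sum>\<sigma>\<in>?S. (\<lambda>c. \<phi> (g \<sigma>) * g' \<sigma> c))" if \<phi>: "\<phi> \<in> simp_cochains K j" for \<phi>
  proof (rule cochain_ext[OF \<phi> cochain_sum])
    show "(\<lambda>c. \<phi> (g \<sigma>) * g' \<sigma> c) \<in> simp_cochains K j" for \<sigma> by (rule cochain_scale[OF g'])
    fix c assume c: "c \<in> simp_chains K j"
    have "\<phi> c = \<phi> (\<Sum>\<sigma>\<in>?S. (\<lambda>v. c (w \<sigma>) * g \<sigma> v))" using expand[OF c] by (rule arg_cong)
    also have "\<dots> = (\<Sum>\<sigma>\<in>?S. \<phi> (\<lambda>v. c (w \<sigma>) * g \<sigma> v))"
      by (rule eval_sum[OF \<phi>]) (rule simp_chains_closed(5)[OF g])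
    also have "\<dots> = (\<Sum>\<sigma>\<in>?S. \<phi> (g \<sigma>) * g' \<sigma> c)"
      by (intro sum.cong refl) (simp add: eval_scale[OF \<phi> g] g'_def cochain_of_apply[OF c])
    finally show "\<phi> c = (\<Sum>\<sigma>\<in>?S. (\<lambda>c. \<phi> (g \<sigma>) * g' \<sigma> c)) c" by (simp only: sum_fun_apply)
  qed
  then show ?thesis
    using fin g g' by (intro exI[of _ ?S] exI[of _ g] exI[of _ g'] conjI ballI allI)
qed

text \<open>A subgroup containing \<open>2A\<close> that is maximal among those avoiding \<open>x\<close> has index 2 in \<open>A\<close>.\<close>

lemma index_two_subgroup:
  fixes x :: "'g::ab_group_add"
  assumes A_add: "\<And>a b. a \<in> A \<Longrightarrow> b \<in> A \<Longrightarrow> a + b \<in> A" and A_uminus: "\<And>a. a \<in> A \<Longrightarrow> - a \<in> A"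
    and W: "W \<subseteq> A" "\<And>a b. a \<in> W \<Longrightarrow> b \<in> W \<Longrightarrow> a + b \<in> W" "\<And>a. a \<in> A \<Longrightarrow> a + a \<in> W"
    and x: "x \<in> A" "x \<notin> W"
  shows "\<exists>M. W \<subseteq> M \<and> x \<notin> M \<and> (\<forall>a\<in>A. \<forall>b\<in>A. a + b \<in> M \<longleftrightarrow> (a \<in> M \<longleftrightarrow> b \<in> M))"
proof -
  define F where "F = {V. W \<subseteq> V \<and> V \<subseteq> A \<and> (\<forall>a\<in>V. \<forall>b\<in>V. a + b \<in> V) \<and> x \<notin> V}"
  have "W \<in> F" using W x by (auto simp: F_def)
  have "\<exists>M\<in>F. \<forall>X\<in>F. M \<subseteq> X \<longrightarrow> X = M"
  proof (rule subset_Zorn_nonempty)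
    show "F \<noteq> {}" using \<open>W \<in> F\<close> by blast
    fix \<C> assume ne: "\<C> \<noteq> {}" and ch: "subset.chain F \<C>"
    have sub: "\<C> \<subseteq> F" using ch by (simp add: subset.chain_def)
    have "a + b \<in> \<Union>\<C>" if "a \<in> \<Union>\<C>" "b \<in> \<Union>\<C>" for a b
    proof -
      from that obtain U V where UV: "U \<in> \<C>" "V \<in> \<C>" "a \<in> U" "b \<in> V" by blast
      then have "U \<subseteq> V \<or> V \<subseteq> U" using ch by (auto simp: subset.chain_def)
      then obtain Z where "Z \<in> \<C>" "a \<in> Z" "b \<in> Z" using UV by blast
      moreover from this sub have "a + b \<in> Z" unfolding F_def by blast
      ultimately show ?thesis by blast
    qed
    moreover have "W \<subseteq> \<Union>\<C>" "\<Union>\<C> \<subseteq> A" "x \<notin> \<Union>\<C>" using ne sub unfolding F_def by blast+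
    ultimately show "\<Union>\<C> \<in> F" unfolding F_def by blast
  qed
  then obtain M where "M \<in> F" and max: "\<And>V. V \<in> F \<Longrightarrow> M \<subseteq> V \<Longrightarrow> V = M" by blast
  then have M: "W \<subseteq> M" "M \<subseteq> A" "x \<notin> M" and M_add: "\<And>a b. a \<in> M \<Longrightarrow> b \<in> M \<Longrightarrow> a + b \<in> M"
    unfolding F_def by blast+
  have double: "a + a \<in> M" if "a \<in> A" for a using W(3)[OF that] M(1) by blast
  \<comment> \<open>This is - a = a + 2 (- a), where the double lies in \<open>M\<close>.\<close>
  have M_uminus: "- a \<in> M" if "a \<in> M" for a
    using M_add[OF that double[of "- a"]] A_uminus that M(2) by auto
  have coset: "x - y \<in> M" if y: "y \<in> A" "y \<notin> M" for y
  proof (rule ccontr)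
    assume n: "x - y \<notin> M"
    \<comment> \<open>Otherwise this would be a larger member of \<open>F\<close>: it is closed
      under addition since 2 y is in \<open>M\<close>, and it avoids \<open>x\<close> since x = m +
      y would put x - y into \<open>M\<close>.\<close>
    let ?V = "M \<union> {m + y |m. m \<in> M}"
    have "(m + y) + (m' + y) \<in> M" if "m \<in> M" "m' \<in> M" for m m'
    proof -
      have "(m + m') + (y + y) \<in> M" by (intro M_add that double y(1))
      then show ?thesis by (simp only: add_ac)
    qed
    moreover have "m + (m' + y) = (m + m') + y" "(m + y) + m' = (m + m') + y" for m m'
      by (simp_all add: algebra_simps)
    ultimately have "\<forall>a\<in>?V. \<forall>b\<in>?V. a + b \<in> ?V"
      using M_add by blast
    moreover have "?V \<subseteq> A" using M(2) y(1) A_add by blast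
    moreover have "x \<notin> ?V" using M(3) n by auto
    ultimately have "?V \<in> F" using M(1) unfolding F_def by blast
    then have "?V = M" using max by blast
    moreover have "0 \<in> M" using M_add[OF M_uminus, of "x + x" "x + x"] double[OF x(1)] by simp
    ultimately have "0 + y \<in> M" by blast
    then show False using y(2) by simp
  qed
  show ?thesis
  proof (intro exI[of _ M] conjI M(1,3) ballI)
    fix a b assume ab: "a \<in> A" "b \<in> A"
    have 1: "a + b \<in> M \<longleftrightarrow> b \<in> M" if "a \<in> M" for a b
      using M_add[OF that, of b] M_add[OF M_uminus[OF that], of "a + b"] by auto
    show "a + b \<in> M \<longleftrightarrow> (a \<in> M \<longleftrightarrow> b \<in> M)"
    proof (cases "a \<in> M")
      case True then show ?thesis using 1 by simp
    next
      case False
      show ?thesis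
      proof (cases "b \<in> M")
        case True then show ?thesis using 1[of b a] False by (simp add: add.commute)
      next
        case b: False
        \<comment> \<open>Up to the double of \<open>x\<close>, the sum is made of x - a and x - b,
          both in \<open>M\<close> by maximality.\<close>
        have "a + b = (x + x) + (- (x - a) + - (x - b))" by (simp add: algebra_simps)
        then have "a + b \<in> M"
          using M_add[OF double[OF x(1)] M_add[OF M_uminus[OF coset] M_uminus[OF coset]]] ab False b
            by simp
        then show ?thesis using False b by simp
      qed
    qed
  qed
qed

text \<open>Membership in a subgroup of index 2 that contains \<open>W\<close> and avoids
  \<open>x\<close> is the kernel of a homomorphism to Z/2. The cochains being free of finite rank,
  such a homomorphism is evaluation modulo 2 at a chain.\<close>

lemma separating_chain:
  assumes K: "finite_complex K"
    and W: "W \<subseteq> simp_cochains K j" "\<And>\<phi> \<psi>. \<phi> \<in> W \<Longrightarrow> \<psi> \<in> W \<Longrightarrow> \<phi> + \<psi> \<in> W"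
      "\<And>\<phi>. \<phi> \<in> simp_cochains K j \<Longrightarrow> \<phi> + \<phi> \<in> W"
    and x: "x \<in> simp_cochains K j" "x \<notin> W"
  shows "\<exists>c\<in>simp_chains K j. (\<forall>\<phi>\<in>W. even (\<phi> c)) \<and> odd (x c)"
proof -
  have "\<exists>M. W \<subseteq> M \<and> x \<notin> M \<and> (\<forall>\<phi>\<in>simp_cochains K j. \<forall>\<psi>\<in>simp_cochains K j.
      \<phi> + \<psi> \<in> M \<longleftrightarrow> (\<phi> \<in> M \<longleftrightarrow> \<psi> \<in> M))"
    by (rule index_two_subgroup) (fact cochain_add cochain_uminus W x)+
  then obtain M where M: "W \<subseteq> M" "x \<notin> M"
    and parity': "\<forall>\<phi>\<in>simp_cochains K j. \<forall>\<psi>\<in>simp_cochains K j. \<phi> + \<psi> \<in> M \<longleftrightarrow> (\<phi> \<in> M \<longleftrightarrow> \<psi> \<in> M)"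
    by (elim exE conjE)
  note parity = parity'[rule_format]
  obtain S :: "'a set set" and g :: "'a set \<Rightarrow> 'a chain" and g' :: "'a set \<Rightarrow> 'a cochain"
    where S: "finite S" and g_all: "\<forall>\<sigma>\<in>S. g \<sigma> \<in> simp_chains K j"
      and g'_all: "\<forall>\<sigma>. g' \<sigma> \<in> simp_cochains K j"
      and basis_all: "\<forall>\<phi>\<in>simp_cochains K j. \<phi> = (\<Sum>\<sigma>\<in>S. (\<lambda>c. \<phi> (g \<sigma>) * g' \<sigma> c))"
    using chain_basis[OF K, of j] by (elim exE conjE)
  note g = g_all[rule_format] and g' = g'_all[rule_format] and basis = basis_all[rule_format]
  have double: "\<phi> + \<phi> \<in> M" if "\<phi> \<in> simp_cochains K j" for \<phi> using W(3)[OF that] M(1) by blast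
  have zero: "0 \<in> M" using double[OF cochain_0] by simp
  have scale: "(\<lambda>c. a * \<phi> c) \<in> M \<longleftrightarrow> even a \<or> \<phi> \<in> M" if \<phi>: "\<phi> \<in> simp_cochains K j" for a \<phi>
  proof -
    have ev: "(\<lambda>c. (2 * k) * \<phi> c) \<in> M" for k
    proof -
      have "(\<lambda>c. (2 * k) * \<phi> c) = (\<lambda>c. k * \<phi> c) + (\<lambda>c. k * \<phi> c)" by auto
      then show ?thesis using double[OF cochain_scale[OF \<phi>, of k]] by simp
    qed
    show ?thesis
    proof (cases "even a")
      case True
      then show ?thesis using ev by (auto elim!: evenE)
    next
      case False
      then obtain k where k: "a = 2 * k + 1" by (rule oddE)
      have "(\<lambda>c. a * \<phi> c) = (\<lambda>c. (2 * k) * \<phi> c) + \<phi>" unfolding k by (auto simp: algebra_simps)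
      then show ?thesis using parity[OF cochain_scale[OF \<phi>, of "2 * k"] \<phi>] ev[of k] False by simp
    qed
  qed
  \<comment> \<open>The values of that homomorphism on the dual basis; they serve as coefficients of
    the chain.\<close>
  define a where "a \<sigma> = (if g' \<sigma> \<in> M then 0 else 1 :: int)" for \<sigma>
  define c where "c = (\<Sum>\<sigma>\<in>S. (\<lambda>w. a \<sigma> * g \<sigma> w))"
  have c: "c \<in> simp_chains K j"
    unfolding c_def using g by (intro simp_chains_closed)
  have in_M_iff: "\<phi> \<in> M \<longleftrightarrow> even (\<phi> c)" if \<phi>: "\<phi> \<in> simp_cochains K j" for \<phi>
  proof -
    have "(\<Sum>\<sigma>\<in>T. (\<lambda>c. b \<sigma> * g' \<sigma> c)) \<in> M \<longleftrightarrow> even (\<Sum>\<sigma>\<in>T. b \<sigma> * a \<sigma>)" if "finite T" for T b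
      using that
    proof (induction T)
      case (insert \<sigma> T)
      have 1: "(\<lambda>c. b \<sigma> * g' \<sigma> c) \<in> simp_cochains K j" by (rule cochain_scale[OF g'])
      have 2: "(\<Sum>\<sigma>\<in>T. (\<lambda>c. b \<sigma> * g' \<sigma> c)) \<in> simp_cochains K j" by (intro cochain_sum cochain_scale g')
      have "(\<Sum>\<sigma>\<in>insert \<sigma> T. (\<lambda>c. b \<sigma> * g' \<sigma> c)) \<in> M \<longleftrightarrow>
          ((\<lambda>c. b \<sigma> * g' \<sigma> c) \<in> M \<longleftrightarrow> (\<Sum>\<sigma>\<in>T. (\<lambda>c. b \<sigma> * g' \<sigma> c)) \<in> M)"
        unfolding sum.insert[OF insert(1,2)] by (rule parity[OF 1 2])
      also have "\<dots> \<longleftrightarrow> even (\<Sum>\<sigma>\<in>insert \<sigma> T. b \<sigma> * a \<sigma>)"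
        using insert scale[OF g', of "b \<sigma>" \<sigma>] by (auto simp: a_def)
      finally show ?case .
    qed (use zero in \<open>simp add: zero_fun_def\<close>)
    from this[OF S, of "\<lambda>\<sigma>. \<phi> (g \<sigma>)"]
    have "\<phi> \<in> M \<longleftrightarrow> even (\<Sum>\<sigma>\<in>S. \<phi> (g \<sigma>) * a \<sigma>)" using basis[OF \<phi>] by simp
    also have "(\<Sum>\<sigma>\<in>S. \<phi> (g \<sigma>) * a \<sigma>) = \<phi> c"
      unfolding c_def using g by (simp add: eval_sum[OF \<phi>] simp_chains_closed(5) eval_scale[OF \<phi>]
        mult.commute)
    finally show ?thesis .
  qed
  show ?thesis
  proof (intro bexI[of _ c] conjI ballI c)
    show "even (\<phi> c)" if "\<phi> \<in> W" for \<phi>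
      using in_M_iff[of \<phi>] that W(1) M(1) by blast
    show "odd (x c)"
      using in_M_iff[OF x(1)] M(2) by simp
  qed
qed

section \<open>Smith classes of joins\<close>

lemma join_simp_chain:
  "c \<in> simp_chains K i \<Longrightarrow> e \<in> simp_chains L j \<Longrightarrow> chain_join c e \<in> simp_chains (complex_join K L) (Suc (i
    + j))"
  using chain_join_chain[of c K "Suc i" e L "Suc j"] by (simp add: simp_chains_eq)

lemma join_unit_simp_chain:
  "c \<in> simp_chains K i \<Longrightarrow> {} \<in> L \<Longrightarrow> chain_join c aug_unit \<in> simp_chains (complex_join K L) i"
  using chain_join_chain[of c K "Suc i" aug_unit L 0] by (simp add: simp_chains_eq aug_unit_chain)

lemma chain_act_pow_join:
  assumes "bij f" "bij g"
  shows "(chain_act (map_sum f g) ^^ k) (chain_join c e) = chain_join ((chain_act f ^^ k) c)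
    ((chain_act g ^^ k) e)"
  by (induction k) (auto simp: chain_act_join[OF assms])

lemma dvd_diff_trans: "q dvd a - b \<Longrightarrow> q dvd b - c \<Longrightarrow> q dvd a - c" for q a b c :: int
  using dvd_add[of q "a - b" "b - c"] by simp

text \<open>\<open>v\<close> is a Bezout inverse of \<open>u\<close> modulo
  \<open>q\<close>.\<close>

lemma coprime_cancel_dvd:
  fixes q u :: int
  assumes "coprime q u"
  shows "\<exists>v. \<forall>x. q dvd x - v * (u * x)"
proof -
  obtain a v where "a * q + v * u = 1" using assms by (metis bezout_int coprime_imp_gcd_eq_1)
  have "x - v * (u * x) = q * (a * x)" for x
  proof -
    have "x = (a * q + v * u) * x" using \<open>a * q + v * u = 1\<close> by simp
    then show ?thesis by (simp add: algebra_simps)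
  qed
  then show ?thesis by (intro exI[of _ v] allI) simp
qed

section \<open>The action on the join and the restriction to its left factor\<close>

locale zp_join =
  K: zp_cx p K t\<^sub>K + L: zp_cx p L t\<^sub>L for p and K :: "'a set set" and t\<^sub>K and L :: "'b set set" and t\<^sub>L
begin

abbreviation "J \<equiv> complex_join K L"
abbreviation "t\<^sub>J \<equiv> map_sum t\<^sub>K t\<^sub>L"

sublocale J: zp_cx p J t\<^sub>J
  using zp_complex_join[OF K.zp L.zp] K.p_pos by unfold_locales

lemmas act_join = chain_act_join[OF K.bij_t L.bij_t]
lemmas act_pow_join = chain_act_pow_join[OF K.bij_t L.bij_t]

lemma boundary_join:
  assumes "c \<in> simp_chains K i"
  shows "aug_boundary J (chain_join c e) =
    (\<lambda>w. chain_join (aug_boundary K c) e w + (-1) ^ Suc i * chain_join c (aug_boundary L e) w)"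
  using aug_boundary_join[OF K.fin L.fin, of c "Suc i"] assms by (simp add: simp_chains_eq)

lemma boundary_join_unit: "aug_boundary J (chain_join c aug_unit) = chain_join
  (aug_boundary K c) aug_unit"
  if "c \<in> simp_chains K i"
  unfolding boundary_join[OF that] aug_boundary_aug_unit by (rule ext) (simp add: chain_join_def)

lemma smop_join_unit:
  "smop p k (chain_act t\<^sub>J) (chain_join c aug_unit) = chain_join (smop p k (chain_act t\<^sub>K) c) aug_unit"
proof -
  have "(chain_act t\<^sub>L ^^ k) aug_unit = aug_unit" for k
    by (induction k) (auto simp: chain_act_aug_unit)
  then have "(chain_act t\<^sub>J ^^ k) (chain_join c aug_unit) = chain_join ((chain_act t\<^sub>K ^^ k) c)
    aug_unit" for k
    by (simp add: act_pow_join)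
  then show ?thesis
    by (cases "even k")
      (simp_all add: smop_def sop_def dop_def chain_join_sum_left chain_join_diff_left act_join
        chain_act_aug_unit)
qed

lemma empty_in: "{} \<in> K" "{} \<in> L"
  using finite_complexD(2) K.fin L.fin by blast+

text \<open>Joining with the empty simplex embeds the chains of K into those of the join; this is
  the restriction of cochains along that embedding.\<close>

definition restrict_left :: "(nat \<Rightarrow> ('a + 'b) cochain) \<Rightarrow> nat \<Rightarrow> 'a cochain" where
  "restrict_left \<phi> j = cochain_of K j (\<lambda>c. \<phi> j (chain_join c aug_unit))"

text \<open>The embedding commutes with boundary, augmentation and action, so each condition on a
  resolution restricts.\<close>

lemma restrict_left_resolution:
  assumes \<phi>: "resolution p J t\<^sub>J \<phi>"
  shows "resolution p K t\<^sub>K (restrict_left \<phi>)"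
proof -
  have in_J: "\<phi> j \<in> simp_cochains J j" for j using \<phi> by (simp add: J.resolution_iff)
  have unit: "smop p 0 (cochain_act t\<^sub>J) (\<phi> 0) = unit_cochain J" using \<phi> by (simp add: J.resolution_iff)
  note chain = join_unit_simp_chain[OF _ empty_in(2), of _ K]
  have in_K: "restrict_left \<phi> j \<in> simp_cochains K j" for j
    unfolding restrict_left_def
    by (rule cochain_of_in) (simp add: chain_join_add_left eval_add[OF in_J] chain)
  have restr: "restrict_left \<phi> j c = \<phi> j (chain_join c aug_unit)" if "c \<in> simp_chains K j" for j c
    unfolding restrict_left_def using that by (rule cochain_of_apply)
  have 0: "smop p 0 (cochain_act t\<^sub>K) (restrict_left \<phi> 0) = unit_cochain K"
  proof (rule cochain_ext[OF K.cochain_smop[OF in_K] unit_cochain_in])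
    fix c assume c: "c \<in> simp_chains K 0"
    have "smop p 0 (cochain_act t\<^sub>K) (restrict_left \<phi> 0) c = smop p 0 (cochain_act t\<^sub>J) (\<phi> 0)
      (chain_join c aug_unit)"
      using c by (simp add: K.smop_eval[OF in_K] J.smop_eval[OF in_J] restr K.smop_chain smop_join_unit
        chain)
    also have "\<dots> = aug_boundary J (chain_join c aug_unit) []"
      unfolding unit by (rule unit_cochain_aug[OF chain[OF c]])
    also have "\<dots> = unit_cochain K c"
      unfolding boundary_join_unit[OF c] unit_cochain_aug[OF c] by (simp add: chain_join_def
        aug_unit_def)
    finally show "smop p 0 (cochain_act t\<^sub>K) (restrict_left \<phi> 0) c = unit_cochain K c" .
  qed
  have step: "simp_coboundary K j (restrict_left \<phi> j) = smop p (Suc j) (cochain_act t\<^sub>K)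
    (restrict_left \<phi> (Suc j))" for j
  proof (rule cochain_ext[OF cochain_coboundary[OF K.fin in_K] K.cochain_smop[OF in_K]])
    fix c assume c: "c \<in> simp_chains K (Suc j)"
    have "simp_coboundary K j (restrict_left \<phi> j) c = \<phi> j (aug_boundary J (chain_join c aug_unit))"
      using c by (simp add: simp_coboundary_apply restr aug_boundary_simp_chain[OF K.fin]
        boundary_join_unit)
    also have "\<dots> = \<phi> (Suc j) (smop p (Suc j) (chain_act t\<^sub>J) (chain_join c aug_unit))"
      using J.resolution_eval[OF \<phi> chain[OF c]] by simp
    also have "\<dots> = smop p (Suc j) (cochain_act t\<^sub>K) (restrict_left \<phi> (Suc j)) c"
      using c by (simp add: K.smop_eval[OF in_K] restr K.smop_chain smop_join_unit)
    finally show "simp_coboundary K j (restrict_left \<phi> j) c =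
      smop p (Suc j) (cochain_act t\<^sub>K) (restrict_left \<phi> (Suc j)) c" .
  qed
  show ?thesis using in_K 0 step by (simp add: K.resolution_iff)
qed

text \<open>The common core of both parts, with n_K = \<open>Suc i\<close> and n_L =
  \<open>Suc l\<close>. The assumption \<open>par\<close> lists the situations in which the sign and
  the parity shift are harmless; \<open>unit\<close> permits u to be cancelled modulo
  \<open>q\<close>.\<close>

lemma join_smith_class:
  assumes c: "c \<in> simp_chains K (Suc i)"
    and inv: "\<And>w. int q dvd dop (chain_act t\<^sub>K) (aug_boundary K c) w"
    and par: "odd i \<or> p = 2 \<and> q = 2"
    and \<phi>: "resolution p J t\<^sub>J \<phi>"
    and unit: "coprime (int q) (restrict_left \<phi> (Suc i) (smop p (Suc i) (chain_act t\<^sub>K) c))"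
    and L: "smith_nonzero_mod p L t\<^sub>L q (Suc l)"
  shows "smith_nonzero_mod p J t\<^sub>J q (Suc (Suc (Suc (i + l))))"
proof (rule ccontr)
  assume zero: "\<not> ?thesis"
  let ?N' = "Suc (Suc (i + l))"
  let ?q = "int q"
  let ?TK = "chain_act t\<^sub>K" and ?TL = "chain_act t\<^sub>L" and ?TJ = "chain_act t\<^sub>J"
  define b where "b = aug_boundary K c"
  have b: "b \<in> simp_chains K i" unfolding b_def using c by (rule aug_boundary_simp_chain[OF K.fin])
  have bb: "aug_boundary K b = 0"
    unfolding b_def using c aug_chains_alternating by (intro aug_boundary_boundary)
      (auto simp: simp_chains_eq)
  have in_J: "\<phi> j \<in> simp_cochains J j" for j using \<phi> by (simp add: J.resolution_iff)
  \<comment> \<open>For odd \<open>i\<close> the sign is 1; otherwise \<open>q = 2\<close> and signs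
    do not matter.\<close>
  have sign: "?q dvd (-1) ^ Suc i * x - x" for x :: int
    using par by (cases "even i") auto
  have b_pow: "?q dvd b w - (?TK ^^ k) b w" for k w
  proof (induction k arbitrary: w)
    case (Suc k)
    have "?q dvd b w - b (map (inv_into UNIV t\<^sub>K) w)"
      using inv[of w] by (simp add: b_def dop_def chain_act_def)
    from dvd_diff_trans[OF this Suc] show ?case by (simp add: chain_act_def)
  qed simp
  \<comment> \<open>By invariance of \<open>b\<close> modulo \<open>q\<close>, acting on
    \<open>e\<close> alone amounts to acting on the join. The condition on \<open>k\<close> and
    \<open>k'\<close> gives them the same parity for odd \<open>i\<close>. For even \<open>i\<close>
    the parities are opposite, but then \<open>p = q = 2\<close> and both operators agree modulo
    2.\<close>
  have smop_join: "?q dvd \<alpha> (chain_join b (smop p k ?TL e)) - \<alpha> (smop p k' ?TJ (chain_join b e))"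
    if e: "e \<in> simp_chains L j" and \<alpha>: "\<alpha> \<in> simp_cochains J (Suc (i + j))" and k: "even (k + k' + Suc i)"
    for e j \<alpha> k k'
  proof (rule eval_dvd_diff[OF \<alpha>])
    show "chain_join b (smop p k ?TL e) \<in> simp_chains J (Suc (i + j))"
      using b L.smop_chain[OF e] by (rule join_simp_chain)
    show "smop p k' ?TJ (chain_join b e) \<in> simp_chains J (Suc (i + j))"
      using join_simp_chain[OF b e] by (rule J.smop_chain)
    fix w
    have pow: "?q dvd chain_join b ((?TL ^^ m) e) w - (?TJ ^^ m) (chain_join b e) w" for m
    proof -
      have "chain_join b ((?TL ^^ m) e) w - (?TJ ^^ m) (chain_join b e) w
          = jsign w * (b (lefts w) - (?TK ^^ m) b (lefts w)) * (?TL ^^ m) e (rights w)"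
        unfolding act_pow_join by (simp add: chain_join_def algebra_simps)
      then show ?thesis using b_pow by simp
    qed
    have "?q dvd chain_join b (smop p k ?TL e) w - smop p k ?TJ (chain_join b e) w"
    proof (cases "even k")
      case True
      have "chain_join b (smop p k ?TL e) w - smop p k ?TJ (chain_join b e) w
        = (\<Sum>m<p. chain_join b ((?TL ^^ m) e) w - (?TJ ^^ m) (chain_join b e) w)"
        using True by (simp add: smop_def sop_def chain_join_sum_right sum_fun_apply sum_subtractf)
      then show ?thesis using pow by (simp add: dvd_sum)
    next
      case False
      have "chain_join b (smop p k ?TL e) w - smop p k ?TJ (chain_join b e) w
        = - (chain_join b (?TL e) w - ?TJ (chain_join b e) w)"
        using False by (simp add: smop_def dop_def chain_join_diff_right)
      then show ?thesis using pow[of 1] by (simp add: dvd_diff_commute)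
    qed
    moreover have "?q dvd smop p k ?TJ (chain_join b e) w - smop p k' ?TJ (chain_join b e) w"
    proof (cases "even i")
      case True
      with par have 2: "p = 2" "q = 2" by auto
      have "smop 2 k ?TJ y w = y w + ?TJ y w \<or> smop 2 k ?TJ y w = y w - ?TJ y w" for k y
        by (simp add: smop_def sop_def dop_def numeral_2_eq_2)
      then have "even (smop 2 k ?TJ y w) \<longleftrightarrow> even (y w + ?TJ y w)" for k y
        by (metis even_add even_diff)
      with 2 show ?thesis by simp
    next
      case False
      then have "even k = even k'" using k by auto
      then show ?thesis using smop_parity[of k k' p ?TJ] by simp
    qed
    ultimately show "?q dvd chain_join b (smop p k ?TL e) w - smop p k' ?TJ (chain_join b e) w"
      by (rule dvd_diff_trans)
  qed
  have boundary_b: "\<alpha> (aug_boundary J (chain_join b e)) = (-1) ^ Suc i * \<alpha> (chain_join b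
    (aug_boundary L e))"
    if \<alpha>: "\<alpha> \<in> simp_cochains J j" and "chain_join b (aug_boundary L e) \<in> simp_chains J j" for \<alpha> j e
  proof -
    have "aug_boundary J (chain_join b e) = (\<lambda>w. (-1) ^ Suc i * chain_join b (aug_boundary L e) w)"
      unfolding boundary_join[OF b] bb by (rule ext) (simp add: chain_join_def)
    then show ?thesis using eval_scale[OF that, of "(-1) ^ Suc i"] by simp
  qed

  define u where "u = \<phi> i (chain_join b aug_unit)"
  have u: "u = restrict_left \<phi> (Suc i) (smop p (Suc i) ?TK c)"
    using c J.resolution_eval[OF \<phi> join_unit_simp_chain[OF c empty_in(2)]]
    by (simp add: u_def restrict_left_def cochain_of_apply K.smop_chain smop_join_unit
      boundary_join_unit b_def)

  define \<chi> where "\<chi> j = cochain_of L j (\<lambda>e. \<phi> (Suc (i + j)) (chain_join b e))" for j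
  have \<chi>_in: "\<chi> j \<in> simp_cochains L j" for j
    unfolding \<chi>_def by (rule cochain_of_in) (simp add: chain_join_add_right eval_add[OF in_J]
      join_simp_chain[OF b])
  have \<chi>_apply: "\<chi> j e = \<phi> (Suc (i + j)) (chain_join b e)" if "e \<in> simp_chains L j" for j e
    unfolding \<chi>_def using that by (rule cochain_of_apply)
  have \<chi>_0: "?q dvd \<chi> 0 (smop p 0 ?TL e) - u * unit_cochain L e" if e: "e \<in> simp_chains L 0" for e
  proof -
    \<comment> \<open>The origin of the factor \<open>u\<close>: the augmented boundary of the
      0-chain \<open>e\<close> is \<epsilon> times the empty simplex, so its join with
      \<open>b\<close> is \<epsilon> times \<open>b\<close> regarded as a chain of the join.\<close>
    define \<epsilon> where "\<epsilon> = aug_boundary L e []"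
    have "aug_boundary L e \<in> aug_chains L 0"
      using e by (intro aug_boundary_chain[OF L.fin]) (simp add: simp_chains_eq)
    have "aug_boundary L e w = \<epsilon> * aug_unit w" for w
      unfolding \<epsilon>_def by (rule fun_cong[OF aug_chain_0_eq[OF \<open>aug_boundary L e \<in> aug_chains L 0\<close>]])
    then have "chain_join b (aug_boundary L e) = (\<lambda>w. \<epsilon> * chain_join b aug_unit w)"
      unfolding chain_join_def by (intro ext) simp
    then have eu: "\<phi> i (chain_join b (aug_boundary L e)) = \<epsilon> * u"
      "chain_join b (aug_boundary L e) \<in> simp_chains J i"
      using join_unit_simp_chain[OF b empty_in(2)]
      by (simp_all add: u_def eval_scale[OF in_J] simp_chains_closed)
    have "?q dvd \<chi> 0 (smop p 0 ?TL e) - \<phi> (Suc i) (smop p (Suc i) ?TJ (chain_join b e))"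
      using smop_join[OF e, of "\<phi> (Suc i)" 0 "Suc i"] in_J by (simp add: \<chi>_apply L.smop_chain[OF e])
    moreover have "\<phi> (Suc i) (smop p (Suc i) ?TJ (chain_join b e)) = (-1) ^ Suc i * (\<epsilon> * u)"
      using J.resolution_eval[OF \<phi>, of "chain_join b e" i] join_simp_chain[OF b e]
        boundary_b[OF in_J eu(2)] eu(1) by simp
    ultimately have "?q dvd \<chi> 0 (smop p 0 ?TL e) - \<epsilon> * u"
      using dvd_diff_trans[OF _ sign[of "\<epsilon> * u"]] by simp
    then show ?thesis using unit_cochain_aug[OF e] by (simp add: \<epsilon>_def mult.commute)
  qed
  have \<chi>_Suc: "?q dvd \<chi> j (aug_boundary L e) - \<chi> (Suc j) (smop p (Suc j) ?TL e)"
    if e: "e \<in> simp_chains L (Suc j)" for j e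
  proof -
    have e': "aug_boundary L e \<in> simp_chains L j" using e by (rule aug_boundary_simp_chain[OF L.fin])
    let ?x = "\<chi> j (aug_boundary L e)" and ?y = "\<phi> (Suc (Suc (i + j))) (smop p (Suc (Suc (i + j))) ?TJ
      (chain_join b e))"
    have "?y = (-1) ^ Suc i * ?x"
      using J.resolution_eval[OF \<phi>, of "chain_join b e" "Suc (i + j)"] join_simp_chain[OF b e]
        boundary_b[OF in_J join_simp_chain[OF b e']] by (simp add: \<chi>_apply[OF e'])
    then have yx: "?q dvd ?y - ?x" using sign[of ?x] by simp
    have "even (Suc j + Suc (Suc (i + j)) + Suc i)" by presburger
    then have "?q dvd \<chi> (Suc j) (smop p (Suc j) ?TL e) - ?y"
      using smop_join[OF e, of "\<phi> (Suc (Suc (i + j)))" "Suc j" "Suc (Suc (i + j))"] in_J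
      by (simp add: \<chi>_apply L.smop_chain[OF e])
    from dvd_diff_trans[OF this yx] show ?thesis by (simp add: dvd_diff_commute)
  qed

  obtain \<phi>\<^sub>L where \<phi>\<^sub>L: "resolution p L t\<^sub>L \<phi>\<^sub>L" using L.resolution_exists by blast
  have in_L: "\<phi>\<^sub>L j \<in> simp_cochains L j" for j using \<phi>\<^sub>L by (simp add: L.resolution_iff)
  have \<phi>\<^sub>L_0: "\<phi>\<^sub>L 0 (smop p 0 ?TL e) = unit_cochain L e" if "e \<in> simp_chains L 0" for e
    using \<phi>\<^sub>L L.smop_eval[OF in_L that, of 0] by (simp add: L.resolution_iff)
  \<comment> \<open>A resolution of 0 modulo \<open>q\<close>, as \<chi> and u times a resolution on
    L start with the same cochain D_0 modulo \<open>q\<close>.\<close>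
  define \<theta> where "\<theta> j = \<chi> j - (\<lambda>e. u * \<phi>\<^sub>L j e)" for j
  have "\<exists>\<alpha>\<in>simp_cochains L l. \<forall>e\<in>simp_chains L (Suc l).
      ?q dvd \<theta> (Suc l) (smop p (Suc l) ?TL e) - \<alpha> (smop p (Suc l) ?TL (aug_boundary L e))"
  proof (rule L.resolution_mod_zero[where \<theta> = \<theta>])
    show "\<theta> j \<in> simp_cochains L j" for j
      unfolding \<theta>_def by (intro cochain_diff cochain_scale \<chi>_in in_L)
    show "?q dvd \<theta> 0 (smop p 0 ?TL e)" if "e \<in> simp_chains L 0" for e
      using \<chi>_0[OF that] by (simp add: \<theta>_def \<phi>\<^sub>L_0[OF that])
    show "?q dvd \<theta> j (aug_boundary L e) - \<theta> (Suc j) (smop p (Suc j) ?TL e)" if "e \<in> simp_chains L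
      (Suc j)" for j e
      using \<chi>_Suc[OF that] by (simp add: \<theta>_def L.resolution_eval[OF \<phi>\<^sub>L that])
  qed
  then obtain \<alpha> where \<alpha>: "\<alpha> \<in> simp_cochains L l"
    and \<theta>_\<alpha>: "\<forall>e\<in>simp_chains L (Suc l).
      ?q dvd \<theta> (Suc l) (smop p (Suc l) ?TL e) - \<alpha> (smop p (Suc l) ?TL (aug_boundary L e))" by blast

  obtain \<psi> where \<psi>: "\<psi> \<in> smith_complex p J t\<^sub>J (Suc ?N') ?N'"
    and bound: "\<forall>x\<in>simp_chains J (Suc ?N'). ?q dvd \<phi> (Suc ?N') (smop p (Suc ?N') ?TJ x) - \<psi>
      (aug_boundary J x)"
    using zero J.smith_nonzero_mod_iff[OF \<phi>] by blast
  have \<psi>_in: "\<psi> \<in> simp_cochains J ?N'" using \<psi> by (simp add: J.smith_complex_eq)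
  have c_join: "chain_join c e \<in> simp_chains J (Suc (Suc (i + j)))" if "e \<in> simp_chains L j" for j e
    using join_simp_chain[OF c that] by simp
  \<comment> \<open>Solve \<partial>(c * De) = b * De + (-1)^i c * D \<partial>e for the first term.
    On the left-hand side \<phi> may be replaced by \<psi> modulo \<open>q\<close>, and \<psi>
    vanishes on b * De; what is left is the difference of \<psi> and \<phi> at c * D \<partial>e,
    with this sign.\<close>
  define \<mu> where "\<mu> = cochain_of L l (\<lambda>e. (-1) ^ i * (\<psi> (chain_join c e) - \<phi> ?N' (chain_join c e)))"
  have \<mu>_in: "\<mu> \<in> simp_cochains L l"
    unfolding \<mu>_def
    by (rule cochain_of_in) (simp add: chain_join_add_right eval_add[OF in_J] eval_add[OF \<psi>_in] c_join
      algebra_simps)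
  have \<chi>_\<mu>: "?q dvd \<chi> (Suc l) (smop p (Suc l) ?TL e) - \<mu> (smop p (Suc l) ?TL (aug_boundary L e))"
    if e: "e \<in> simp_chains L (Suc l)" for e
  proof -
    let ?e = "smop p (Suc l) ?TL e" and ?e' = "smop p (Suc l) ?TL (aug_boundary L e)"
    have e': "?e' \<in> simp_chains L l" using aug_boundary_simp_chain[OF L.fin e] by (rule L.smop_chain)
    have De: "?e \<in> simp_chains L (Suc l)" using e by (rule L.smop_chain)
    have boundary_c: "\<beta> (aug_boundary J (chain_join c ?e)) = \<beta> (chain_join b ?e) + (-1) ^ i * \<beta>
      (chain_join c ?e')"
      if \<beta>: "\<beta> \<in> simp_cochains J ?N'" for \<beta>
    proof -
      have "aug_boundary J (chain_join c ?e) = chain_join b ?e + (\<lambda>w. (-1) ^ i * chain_join c ?e' w)"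
        unfolding boundary_join[OF c] L.boundary_smop b_def by (rule ext) simp
      then show ?thesis
        using eval_add[OF \<beta>, of "chain_join b ?e" "\<lambda>w. (-1) ^ i * chain_join c ?e' w"]
          eval_scale[OF \<beta>, of "chain_join c ?e'" "(-1) ^ i"] c_join[OF e'] join_simp_chain[OF b De]
        by (simp add: simp_chains_closed)
    qed
    \<comment> \<open>With N = \<open>Suc ?N'\<close>: the value of \<psi> at b * De is congruent to
      its value at D_(N+1) applied to b * e, which is 0 because \<psi> lies in ker D_(N+1).\<close>
    have "even (Suc l + Suc (Suc ?N') + Suc i)" by presburger
    then have "?q dvd \<psi> (chain_join b ?e) - \<psi> (smop p (Suc (Suc ?N')) ?TJ (chain_join b e))"
      using smop_join[OF e, of \<psi> "Suc l" "Suc (Suc ?N')"] \<psi>_in by simp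
    then have 1: "?q dvd \<psi> (chain_join b ?e)"
      using J.smith_complex_eval[OF \<psi>, of "chain_join b e"] join_simp_chain[OF b e] by simp
    have ce: "chain_join c ?e \<in> simp_chains J (Suc ?N')" using c_join[OF De] by simp
    have 2: "?q dvd \<phi> ?N' (aug_boundary J (chain_join c ?e)) - \<psi> (aug_boundary J (chain_join c ?e))"
      using bound[rule_format, OF ce] unfolding J.resolution_eval[OF \<phi> ce] .
    have "\<chi> (Suc l) ?e - \<mu> ?e' = (\<phi> ?N' (aug_boundary J (chain_join c ?e)) - \<psi> (aug_boundary J
      (chain_join c ?e)))
        + \<psi> (chain_join b ?e)"
      unfolding boundary_c[OF in_J] boundary_c[OF \<psi>_in]
      by (simp add: \<mu>_def cochain_of_apply[OF e'] \<chi>_apply[OF De] algebra_simps)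
    with 1 2 show ?thesis by (metis dvd_add)
  qed

  obtain v where v: "\<forall>x. ?q dvd x - v * (u * x)"
    using coprime_cancel_dvd unit unfolding u[symmetric] by blast
  \<comment> \<open>Modulo \<open>q\<close>, u times D of the resolution on L is the coboundary of D
    (\<mu> - \<alpha>), and \<open>v\<close> inverts u. It is D \<beta>, and not \<beta>, that lies
    in the kernel required by the criterion.\<close>
  define \<beta> where "\<beta> = (\<lambda>e. v * (\<mu> - \<alpha>) e)"
  have \<beta>: "\<beta> \<in> simp_cochains L l" unfolding \<beta>_def by (intro cochain_scale cochain_diff \<mu>_in \<alpha>)
  have "?q dvd \<phi>\<^sub>L (Suc l) (smop p (Suc l) ?TL e) - smop p (Suc l) (cochain_act t\<^sub>L) \<beta>
    (aug_boundary L e)"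
    if e: "e \<in> simp_chains L (Suc l)" for e
  proof -
    let ?x = "\<phi>\<^sub>L (Suc l) (smop p (Suc l) ?TL e)" and ?e' = "smop p (Suc l) ?TL (aug_boundary L e)"
    have "?q dvd (\<chi> (Suc l) (smop p (Suc l) ?TL e) - \<mu> ?e') - (\<theta> (Suc l) (smop p (Suc l) ?TL e) - \<alpha> ?e')"
      using \<chi>_\<mu>[OF e] \<theta>_\<alpha>[rule_format, OF e] by (rule dvd_diff)
    then have "?q dvd u * ?x - (\<mu> ?e' - \<alpha> ?e')" by (simp add: \<theta>_def algebra_simps)
    then have "?q dvd v * (u * ?x - (\<mu> ?e' - \<alpha> ?e'))" by (rule dvd_mult)
    then have "?q dvd (?x - v * (u * ?x)) + v * (u * ?x - (\<mu> ?e' - \<alpha> ?e'))"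
      using v[rule_format] by (intro dvd_add)
    moreover have "(?x - v * (u * ?x)) + v * (u * ?x - (\<mu> ?e' - \<alpha> ?e')) = ?x - \<beta> ?e'"
      by (simp add: \<beta>_def algebra_simps)
    ultimately show ?thesis
      using L.smop_eval[OF \<beta> aug_boundary_simp_chain[OF L.fin e]] by simp
  qed
  then have "\<not> smith_nonzero_mod p L t\<^sub>L q (Suc l)"
    using L.smith_nonzero_mod_iff[OF \<phi>\<^sub>L] L.smop_in_smith_complex[OF \<beta>] by blast
  with L show False by blast
qed

end

section \<open>Dual chains at the prime 2 and the theorem\<close>

context zp_cx
begin

text \<open>\<open>W\<close> consists of the cochains congruent modulo 2 to coboundaries from the
  subcomplex, so non-vanishing places D \<phi> outside \<open>W\<close>. A separating chain pairs
  evenly with the coboundary of D \<epsilon> for every \<epsilon>. Taking the coefficient at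
  \<open>w\<close> for \<epsilon> makes D \<partial>c even at each \<open>w\<close>, and for
  \<open>p = 2\<close> this D agrees with \<open>d\<close> modulo 2 in either parity.\<close>

lemma dual_mod_2:
  assumes p: "p = 2" and \<phi>: "resolution p K t \<phi>" and nz: "smith_nonzero_mod p K t 2 (Suc i)"
  shows "\<exists>c\<in>simp_chains K (Suc i). (\<forall>w. even (dop (chain_act t) (aug_boundary K c) w)) \<and>
    odd (\<phi> (Suc i) (smop p (Suc i) (chain_act t) c))"
proof -
  interpret int_complex "smith_complex p K t (Suc i)" "simp_coboundary K" by (rule smith_int_complex)
  have in_K: "\<phi> (Suc i) \<in> simp_cochains K (Suc i)" using \<phi> by (simp add: resolution_iff)
  let ?x = "smop p (Suc i) (cochain_act t) (\<phi> (Suc i))"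
  define W where "W = {\<omega> \<in> simp_cochains K (Suc i). \<exists>\<psi>\<in>smith_complex p K t (Suc i) i.
    \<forall>c\<in>simp_chains K (Suc i). even (\<omega> c - \<psi> (aug_boundary K c))}"
  have x: "?x \<in> simp_cochains K (Suc i)" using in_K by (rule cochain_smop)
  have "?x \<notin> W"
    using nz unfolding smith_nonzero_mod_iff[OF \<phi>] W_def by (auto simp: smop_eval[OF in_K])
  have W_add: "\<omega> + \<omega>' \<in> W" if "\<omega> \<in> W" "\<omega>' \<in> W" for \<omega> \<omega>'
  proof -
    obtain \<psi> \<psi>' where \<psi>: "\<psi> \<in> smith_complex p K t (Suc i) i" "\<psi>' \<in> smith_complex p K t (Suc i) i"
      "\<forall>c\<in>simp_chains K (Suc i). even (\<omega> c - \<psi> (aug_boundary K c))"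
      "\<forall>c\<in>simp_chains K (Suc i). even (\<omega>' c - \<psi>' (aug_boundary K c))"
      using \<open>\<omega> \<in> W\<close> \<open>\<omega>' \<in> W\<close> unfolding W_def by blast
    have "even ((\<omega> + \<omega>') c - (\<psi> + \<psi>') (aug_boundary K c))" if "c \<in> simp_chains K (Suc i)" for c
      using \<psi>(3,4)[rule_format, OF that] by simp
    moreover have "\<omega> + \<omega>' \<in> simp_cochains K (Suc i)"
      using that unfolding W_def by (simp add: cochain_add)
    ultimately show ?thesis using C_add[OF \<psi>(1,2)] unfolding W_def by blast
  qed
  have W_double: "\<omega> + \<omega> \<in> W" if "\<omega> \<in> simp_cochains K (Suc i)" for \<omega>
    unfolding W_def using cochain_add[OF that that] by (intro CollectI conjI bexI[of _ 0] C_0 ballI)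
      simp_all
  have W_coboundary: "simp_coboundary K i \<psi> \<in> W" if "\<psi> \<in> smith_complex p K t (Suc i) i" for \<psi>
    using that unfolding W_def
    by (auto intro!: cochain_coboundary fin bexI[of _ \<psi>] simp: smith_complex_eq simp_coboundary_apply)
  have W_sub: "W \<subseteq> simp_cochains K (Suc i)" unfolding W_def by blast
  have "\<exists>c\<in>simp_chains K (Suc i). (\<forall>\<omega>\<in>W. even (\<omega> c)) \<and> odd (?x c)"
    by (rule separating_chain) (fact fin W_sub W_add W_double x \<open>?x \<notin> W\<close>)+
  then obtain c where c: "c \<in> simp_chains K (Suc i)" "\<forall>\<omega>\<in>W. even (\<omega> c)" "odd (?x c)"
    by blast
  let ?b = "aug_boundary K c"
  have b: "?b \<in> simp_chains K i" using fin c(1) by (rule aug_boundary_simp_chain)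
  have "even (dop (chain_act t) ?b w)" for w
  proof -
    define \<epsilon> where "\<epsilon> = cochain_of K i (\<lambda>c. c w)"
    have \<epsilon>: "\<epsilon> \<in> simp_cochains K i" unfolding \<epsilon>_def by (rule cochain_of_in) simp
    have "even (simp_coboundary K i (smop p (Suc i) (cochain_act t) \<epsilon>) c)"
      using \<epsilon> by (intro c(2)[rule_format] W_coboundary smop_in_smith_complex)
    then have "even (smop p (Suc i) (chain_act t) ?b w)"
      using c(1) b by (simp add: simp_coboundary_apply smop_eval[OF \<epsilon>]) (simp add: \<epsilon>_def
        cochain_of_apply smop_chain)
    then show ?thesis
      unfolding p smop_def by (auto simp: sop_def dop_def numeral_2_eq_2 split: if_splits)
  qed
  with c show ?thesis by (intro bexI[of _ c] conjI allI) (simp_all add: smop_eval[OF in_K])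
qed

end

theorem theorem4:
  fixes p n\<^sub>K n\<^sub>L :: nat
    and K :: "'a set set" and t\<^sub>K :: "'a \<Rightarrow> 'a"
    and L :: "'b set set" and t\<^sub>L :: "'b \<Rightarrow> 'b"
  assumes "prime p"
    and "zp_complex p K t\<^sub>K" and "zp_complex p L t\<^sub>L"
    and "n\<^sub>K > 0" and "n\<^sub>L > 0"
  shows
    "(p = 2 \<and> smith_nonzero_mod p K t\<^sub>K 2 n\<^sub>K \<and> smith_nonzero_mod p L t\<^sub>L 2 n\<^sub>L \<longrightarrow>
        smith_nonzero_mod p (complex_join K L) (map_sum t\<^sub>K t\<^sub>L) 2 (n\<^sub>K + n\<^sub>L + 1)) \<and>
     (\<forall>m\<ge>1. even n\<^sub>K \<and> smith_nonzero_mod p K t\<^sub>K p n\<^sub>K \<and>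
        smith_nonzero_mod p L t\<^sub>L (p ^ m) n\<^sub>L \<and>
        (\<forall>m'. 1 \<le> m' \<and> m' < m \<longrightarrow> \<not> smith_nonzero_mod p L t\<^sub>L (p ^ m') n\<^sub>L) \<and>
        (\<exists>c. smith_dual p K t\<^sub>K n\<^sub>K c \<and> boundary_equivariant_mod (p ^ m) K t\<^sub>K c) \<longrightarrow>
        smith_nonzero_mod p (complex_join K L) (map_sum t\<^sub>K t\<^sub>L) (p ^ m) (n\<^sub>K + n\<^sub>L + 1))"
proof -
  interpret zp_join p K t\<^sub>K L t\<^sub>L
    using assms prime_gt_0_nat by unfold_locales
  obtain i l where n: "n\<^sub>K = Suc i" "n\<^sub>L = Suc l"
    using assms(4,5) gr0_implies_Suc by metis
  have N: "n\<^sub>K + n\<^sub>L + 1 = Suc (Suc (Suc (i + l)))" unfolding n by simp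
  obtain \<phi> where \<phi>: "resolution p J t\<^sub>J \<phi>" using J.resolution_exists by blast
  note res = restrict_left_resolution[OF \<phi>]
  show ?thesis
    unfolding N unfolding n
  proof (intro conjI impI allI)
    assume A: "p = 2 \<and> smith_nonzero_mod p K t\<^sub>K 2 (Suc i) \<and> smith_nonzero_mod p L t\<^sub>L 2 (Suc l)"
    then have p2: "p = 2" and nzK: "smith_nonzero_mod p K t\<^sub>K 2 (Suc i)"
      and nzL: "smith_nonzero_mod p L t\<^sub>L 2 (Suc l)" by blast+
    obtain c where "c \<in> simp_chains K (Suc i)" "\<forall>w. even (dop (chain_act t\<^sub>K) (aug_boundary K c) w)"
      "odd (restrict_left \<phi> (Suc i) (smop p (Suc i) (chain_act t\<^sub>K) c))"
      using K.dual_mod_2[OF p2 res nzK] by blast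
    then show "smith_nonzero_mod p J t\<^sub>J 2 (Suc (Suc (Suc (i + l))))"
      using p2 nzL by (intro join_smith_class[OF _ _ _ \<phi>]) (simp_all add: coprime_left_2_iff_odd)
  next
    fix m :: nat
    assume "1 \<le> m" and A: "even (Suc i) \<and> smith_nonzero_mod p K t\<^sub>K p (Suc i) \<and>
      smith_nonzero_mod p L t\<^sub>L (p ^ m) (Suc l) \<and>
      (\<forall>m'. 1 \<le> m' \<and> m' < m \<longrightarrow> \<not> smith_nonzero_mod p L t\<^sub>L (p ^ m') (Suc l)) \<and>
      (\<exists>c. smith_dual p K t\<^sub>K (Suc i) c \<and> boundary_equivariant_mod (p ^ m) K t\<^sub>K c)"
    then have i: "odd i" and nzL: "smith_nonzero_mod p L t\<^sub>L (p ^ m) (Suc l)" by auto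
    obtain c where dual: "smith_dual p K t\<^sub>K (Suc i) c" and equiv: "boundary_equivariant_mod
      (p ^ m) K t\<^sub>K c"
      using A by blast
    note c = K.smith_dual_eval[OF dual i res]
    show "smith_nonzero_mod p J t\<^sub>J (p ^ m) (Suc (Suc (Suc (i + l))))"
    proof (rule join_smith_class[OF c(1) _ _ \<phi> _ nzL])
      show "int (p ^ m) dvd dop (chain_act t\<^sub>K) (aug_boundary K c) w" for w
        using equiv by (simp add: boundary_equivariant_mod_def chain_cong_0_def simp_boundary_eq[OF
          c(1)])
      \<comment> \<open>The dual only guarantees a value that is non-zero modulo \<open>p\<close>;
        primality makes it a unit modulo every power of \<open>p\<close>.\<close>
      have "prime (int p)" using assms(1) by simp
      then have "coprime (int p) (restrict_left \<phi> (Suc i) (smop p (Suc i) (chain_act t\<^sub>K) c))"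
        using c(2) by (rule prime_imp_coprime)
      then show "coprime (int (p ^ m)) (restrict_left \<phi> (Suc i) (smop p (Suc i) (chain_act t\<^sub>K) c))"
        by simp
    qed (use i in simp)
  qed
qed

end
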